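(* Let $a:[0,1]\times[0,2\pi]\to\mathbb{C}$ be a function with Fourier series $a(x,t)=\sum_{k\in\mathbb{Z}}\hat a_k(x)e^{ikt}$ such that $x\mapsto a(x,t)$ is Riemann integrable on $[0,1]$ for every $t$, $t\mapsto a(x,t)$ belongs to $L^\infty([0,2\pi])$ for every $x$, and $|||a|||:=\sum_{k\in\mathbb{Z}}\|\hat a_k\|_\infty<\infty$. Suppose that the KMS matrix $T_n(a)$ is normal for every $n$. Then for every continuous function $\varphi:D_a\to\mathbb{C}$ on the closed disk $D_a=\{z\in\mathbb{C}:|z|\le |||a|||\}$, $$\lim_{n\to\infty}\frac{\operatorname{Tr}[\varphi(T_n(a))]}{n+1}=\frac{1}{2\pi}\int_0^1\int_0^{2\pi}\varphi(a(x,t))\,dt\,dx .$$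
   Context: For a function $a(x,t)$ on $[0,1]\times[0,2\pi]$ with Fourier series $a(x,t)=\sum_{k\in\mathbb{Z}}\hat a_k(x)e^{ikt}$, where $\hat a_k(x)=\frac1{2\pi}\int_0^{2\pi}a(x,t)e^{-ikt}\,dt$, the Kac-Murdock-Szegő (KMS) matrix with symbol $a$ is the $(n+1)\times(n+1)$ matrix $$T_n(a)=\left[\hat a_{j-i}\left(\frac{i+j}{2n+2}\right)\right]_{i,j=0}^n .$$ Here $\|\hat a_k\|_\infty=\sup_{x\in[0,1]}|\hat a_k(x)|$. Under $|||a|||<\infty$ the Fourier series converges absolutely and uniformly, and $a$ is identified with its sum; all eigenvalues of $T_n(a)$ lie in $D_a$. For a normal matrix $T$ with eigenvalues $\lambda_1,\dots,\lambda_{n+1}$ (with multiplicity), $\operatorname{Tr}[\varphi(T)]=\sum_j\varphi(\lambda_j)$. *)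

theory Defs
  imports
    "HOL-Analysis.Analysis"
    "Jordan_Normal_Form.Char_Poly"
    "Jordan_Normal_Form.Schur_Decomposition"
begin

text \<open>
  Riemann integrability in the classical sense: the Riemann sums converge as the mesh tends to 0,
  uniformly over all tagged divisions. The integral of \<^theory>\<open>HOL-Analysis.Henstock_Kurzweil_Integration\<close>
  allows gauges that depend on the tag and is strictly more general.
\<close>

definition riemann_integrable_on :: "(real \<Rightarrow> 'b::real_normed_vector) \<Rightarrow> real set \<Rightarrow> bool"
    (infixr "riemann'_integrable'_on" 46) where
  "f riemann_integrable_on S \<longleftrightarrow>
     (\<exists>I. \<forall>\<epsilon>>0. \<exists>\<delta>>0. \<forall>D. D tagged_division_of S \<and> (\<forall>(x, K) \<in> D. diameter K < \<delta>)
        \<longrightarrow> norm ((\<Sum>(x, K) \<in> D. measure lborel K *\<^sub>R f x) - I) < \<epsilon>)"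

definition essentially_bounded_on :: "(real \<Rightarrow> 'b::{real_normed_vector,second_countable_topology}) \<Rightarrow> real set \<Rightarrow> bool"
    (infixr "essentially'_bounded'_on" 46) where
  "f essentially_bounded_on S \<longleftrightarrow>
     f \<in> borel_measurable (lebesgue_on S) \<and> (\<exists>C. AE t in lebesgue_on S. norm (f t) \<le> C)"

definition fourier_coeff :: "(real \<Rightarrow> real \<Rightarrow> complex) \<Rightarrow> int \<Rightarrow> real \<Rightarrow> complex" where
  "fourier_coeff a k x =
     (LINT t|lebesgue_on {0..2*pi}. a x t * exp (- \<i> * of_int k * of_real t)) / of_real (2 * pi)"

text \<open>The value is extended real, so that finiteness of the norm is a genuine condition.\<close>

definition symbol_norm :: "(real \<Rightarrow> real \<Rightarrow> complex) \<Rightarrow> ennreal" where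
  "symbol_norm a = (\<Sum>\<^sub>\<infinity>k\<in>UNIV. SUP x\<in>{0..1}. ennreal (norm (fourier_coeff a k x)))"

definition symbol_disk :: "(real \<Rightarrow> real \<Rightarrow> complex) \<Rightarrow> complex set" where
  "symbol_disk a = {z. ennreal (norm z) \<le> symbol_norm a}"

definition kms_matrix :: "(real \<Rightarrow> real \<Rightarrow> complex) \<Rightarrow> nat \<Rightarrow> complex mat" where
  "kms_matrix a n = Matrix.mat (n + 1) (n + 1)
     (\<lambda>(i, j). fourier_coeff a (int j - int i) (real (i + j) / real (2 * n + 2)))"

definition normal_mat :: "complex mat \<Rightarrow> bool" where
  "normal_mat A \<longleftrightarrow> square_mat A \<and> A * mat_adjoint A = mat_adjoint A * A"

text \<open>
  The sum runs over the eigenvalues with multiplicity; for normal matrices the algebraic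
  multiplicity used here coincides with the geometric one.
\<close>

definition trace_fun :: "(complex \<Rightarrow> complex) \<Rightarrow> complex mat \<Rightarrow> complex" where
  "trace_fun \<phi> A = (\<Sum>z\<in>#proots (char_poly A). \<phi> z)"

end

theory Submission
  imports Defs "Jordan_Normal_Form.Jordan_Normal_Form_Existence"
begin

text \<open>
  For a normal matrix, the trace of \<open>\<phi>(T)\<close> with \<open>\<phi>(z) = z\<^sup>p cnj(z)\<^sup>q\<close> is the trace of the word
  \<open>T\<^sup>p (T\<^sup>*)\<^sup>q\<close>, and by Stone--Weierstrass it suffices to treat such monomials, since all
  eigenvalues lie in the disk. The mean of the diagonal of a word is the integral over \<open>x \<in> [0,1]\<close> of
  its diagonal entry in row \<open>\<lfloor>(n + 1) x\<rfloor>\<close>. Riemann integrability makes \<open>a(\<cdot>, t)\<close>, and hence all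
  Fourier coefficients, continuous at almost every \<open>x\<close>. At such an \<open>x\<close> the matrix looks, near that row,
  like the Toeplitz matrix with symbol \<open>a(x, \<cdot>)\<close>, so the entry converges to the zeroth Fourier
  coefficient of \<open>a(x, \<cdot>)\<^sup>p cnj(a(x, \<cdot>))\<^sup>q\<close>; dominated convergence in \<open>x\<close> concludes.
\<close>

section \<open>Normal matrices\<close>

text \<open>Following one row turns the limit into an induction on word length, but the diagonal
  entry alone does not close it, since one more factor mixes all offsets from the diagonal. So the
  statement carried along is that the entry at every offset \<open>k\<close> tends to the
  \<open>k\<close>-th Fourier coefficient of the matching power product; a factor on the right then
  acts as a convolution. The exchanges of sums and limits rest on one summable majorant
  \<open>A\<close> of the coefficients, uniform in \<open>x\<close> and in the matrix size. Its sum
  \<open>M\<close> bounds the symbol and the eigenvalues, and powers of \<open>M\<close> bound the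
  entries of the words. On the spectral side it suffices to have one basis, unitary or not, that
  diagonalizes the matrix and its adjoint at once; it is read off the Jordan form. The null set of
  exceptional \<open>x\<close> has to serve all \<open>t\<close> at once, which is where
  equicontinuity in \<open>t\<close> enters. Stone-Weierstrass applies on the disk of radius
  \<open>M\<close>, because both sides of the limit are averages of values taken there and so are
  bounded by the maximum over that disk.\<close>

lemma index_mat_adjoint [simp]:
  assumes "i < dim_col A" "j < dim_row A"
  shows "mat_adjoint A $$ (i, j) = conjugate (A $$ (j, i))"
  using assms unfolding mat_adjoint_def
  by (simp add: mat_of_rows_def)

lemma dim_mat_adjoint [simp]:
  "dim_row (mat_adjoint A) = dim_col A" "dim_col (mat_adjoint A) = dim_row A"
  unfolding mat_adjoint_def by auto

lemma mat_adjoint_carrier [simp, intro]: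
  "A \<in> carrier_mat n m \<Longrightarrow> mat_adjoint A \<in> carrier_mat m n"
  unfolding carrier_mat_def by auto

lemma index_mult_mat_sum:
  assumes "A \<in> carrier_mat n m" "B \<in> carrier_mat m k" "i < n" "j < k"
  shows "(A * B) $$ (i, j) = (\<Sum>l<m. A $$ (i, l) * B $$ (l, j))"
  using assms by (simp add: scalar_prod_def lessThan_atLeast0)

lemma mat_adjoint_mult:
  fixes A B :: "complex mat"
  assumes A: "A \<in> carrier_mat n m" and B: "B \<in> carrier_mat m k"
  shows "mat_adjoint (A * B) = mat_adjoint B * mat_adjoint A"
proof (rule eq_matI)
  have A': "mat_adjoint A \<in> carrier_mat m n" and B': "mat_adjoint B \<in> carrier_mat k m"
    using A B by auto
  fix i j assume "i < dim_row (mat_adjoint B * mat_adjoint A)" "j < dim_col (mat_adjoint B * mat_adjoint A)"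
  then have ij: "i < k" "j < n" using A B by auto
  then show "mat_adjoint (A * B) $$ (i, j) = (mat_adjoint B * mat_adjoint A) $$ (i, j)"
    using A B
    by (simp add: index_mult_mat_sum[OF B' A'] index_mult_mat_sum[OF A B] mult.commute
        del: index_mult_mat(1))
qed (use A B in auto)

lemma mat_adjoint_adjoint [simp]:
  fixes A :: "complex mat"
  shows "mat_adjoint (mat_adjoint A) = A"
  by (rule eq_matI) auto

text \<open>Diagonal entry \<open>j\<close> of the product is the squared Euclidean norm of column
  \<open>j\<close> of \<open>Y\<close>, so every column vanishes.\<close>

lemma adjoint_mult_self_eq_0:
  fixes Y :: "complex mat"
  assumes Y: "Y \<in> carrier_mat n m" and 0: "mat_adjoint Y * Y = 0\<^sub>m m m"
  shows "Y = 0\<^sub>m n m"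
proof (rule eq_matI)
  fix i j assume "i < dim_row (0\<^sub>m n m)" "j < dim_col (0\<^sub>m n m)"
  then have ij: "i < n" "j < m" by auto
  have "0 = (mat_adjoint Y * Y) $$ (j, j)" using 0 ij by simp
  also have "\<dots> = (\<Sum>l<n. mat_adjoint Y $$ (j, l) * Y $$ (l, j))"
    using Y ij by (intro index_mult_mat_sum) auto
  also have "\<dots> = (\<Sum>l<n. of_real ((norm (Y $$ (l, j)))\<^sup>2))"
    using Y ij by (intro sum.cong refl) (auto simp: complex_norm_square mult.commute simp del: of_real_power)
  finally have "(\<Sum>l<n. (norm (Y $$ (l, j)))\<^sup>2) = 0"
    by (metis of_real_eq_0_iff of_real_sum)
  then have "(norm (Y $$ (i, j)))\<^sup>2 = 0"
    using ij by (subst (asm) sum_nonneg_eq_0_iff) auto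
  then show "Y $$ (i, j) = 0\<^sub>m n m $$ (i, j)" using ij by simp
qed (use Y in auto)

text \<open>With \<open>M'\<close> for the adjoint of \<open>M\<close>, the Gram matrix of
  \<open>M' X\<close> is \<open>X' M M' X\<close>, and normality rewrites it as
  \<open>X' M' M X = 0\<close>. Applied to shifts of \<open>A\<close>, this makes eigenvectors of
  \<open>A\<close> eigenvectors of its adjoint.\<close>

lemma normal_adjoint_kernel:
  fixes M X :: "complex mat"
  assumes M: "M \<in> carrier_mat n n" and X: "X \<in> carrier_mat n m"
    and normal: "M * mat_adjoint M = mat_adjoint M * M"
    and ker: "M * X = 0\<^sub>m n m"
  shows "mat_adjoint M * X = 0\<^sub>m n m"
proof (rule adjoint_mult_self_eq_0)
  have c: "mat_adjoint M \<in> carrier_mat n n" "mat_adjoint X \<in> carrier_mat m n" using M X by auto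
  have "mat_adjoint (mat_adjoint M * X) * (mat_adjoint M * X)
      = (mat_adjoint X * M) * (mat_adjoint M * X)"
    by (subst mat_adjoint_mult[OF c(1) X]) simp
  also have "\<dots> = mat_adjoint X * (M * (mat_adjoint M * X))"
    using c X M by (intro assoc_mult_mat) auto
  also have "M * (mat_adjoint M * X) = (M * mat_adjoint M) * X"
    using c X M by (intro assoc_mult_mat[symmetric]) auto
  also have "\<dots> = mat_adjoint M * (M * X)"
    unfolding normal using c X M by (intro assoc_mult_mat) auto
  also have "\<dots> = 0\<^sub>m n m" using ker right_mult_zero_mat[OF c(1)] by simp
  finally show "mat_adjoint (mat_adjoint M * X) * (mat_adjoint M * X) = 0\<^sub>m m m"
    using right_mult_zero_mat[OF c(2)] by simp
qed (use M X in auto)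

lemma minus_smult_one_mult:
  fixes C D :: "'a :: comm_ring_1 mat"
  assumes "C \<in> carrier_mat n n" "D \<in> carrier_mat n m"
  shows "(C - f \<cdot>\<^sub>m 1\<^sub>m n) * D = C * D - f \<cdot>\<^sub>m D"
  using assms by (simp add: minus_mult_distrib_mat[of _ n n _ _ m] mult_smult_assoc_mat[of _ n n _ m])

lemma mult_minus_smult_one:
  fixes C D :: "'a :: comm_ring_1 mat"
  assumes "C \<in> carrier_mat m n" "D \<in> carrier_mat n n"
  shows "C * (D - f \<cdot>\<^sub>m 1\<^sub>m n) = C * D - f \<cdot>\<^sub>m C"
  using assms by (simp add: mult_minus_distrib_mat[of _ m n _ n] mult_smult_distrib[of _ m n _ n])

lemma normal_shift:
  fixes A :: "complex mat"
  assumes A: "A \<in> carrier_mat n n" and normal: "A * mat_adjoint A = mat_adjoint A * A"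
  defines "M \<equiv> \<lambda>e. A - e \<cdot>\<^sub>m 1\<^sub>m n"
  shows "mat_adjoint (M e) = mat_adjoint A - cnj e \<cdot>\<^sub>m 1\<^sub>m n"
    and "M e * mat_adjoint (M e) = mat_adjoint (M e) * M e"
proof -
  show adj: "mat_adjoint (M e) = mat_adjoint A - cnj e \<cdot>\<^sub>m 1\<^sub>m n"
    unfolding M_def using A by (intro eq_matI) auto
  let ?B = "mat_adjoint A"
  have B: "?B \<in> carrier_mat n n" using A by auto
  show "M e * mat_adjoint (M e) = mat_adjoint (M e) * M e"
  proof -
    have c: "A - e \<cdot>\<^sub>m 1\<^sub>m n \<in> carrier_mat n n" "?B - cnj e \<cdot>\<^sub>m 1\<^sub>m n \<in> carrier_mat n n"
      using A B by auto
    have "M e * mat_adjoint (M e) = A * ?B - cnj e \<cdot>\<^sub>m A - e \<cdot>\<^sub>m (?B - cnj e \<cdot>\<^sub>m 1\<^sub>m n)"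
      unfolding adj unfolding M_def minus_smult_one_mult[OF A c(2)] mult_minus_smult_one[OF A B] ..
    also have "\<dots> = ?B * A - e \<cdot>\<^sub>m ?B - cnj e \<cdot>\<^sub>m (A - e \<cdot>\<^sub>m 1\<^sub>m n)"
      unfolding normal using A B by (intro eq_matI) (auto simp: algebra_simps)
    also have "\<dots> = mat_adjoint (M e) * M e"
      unfolding adj unfolding M_def minus_smult_one_mult[OF B c(1)] mult_minus_smult_one[OF B A] ..
    finally show ?thesis .
  qed
qed

section \<open>Diagonalization of normal matrices from the Jordan form\<close>

lemma jordan_matrix_bidiagonal:
  fixes n_as :: "(nat \<times> 'a :: {zero,one}) list"
  assumes "i < sum_list (map fst n_as)" "j < sum_list (map fst n_as)"
    and "jordan_matrix n_as $$ (i, j) \<noteq> 0"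
  shows "j = i \<or> j = Suc i \<and> jordan_matrix n_as $$ (i, i) = jordan_matrix n_as $$ (j, j)"
  using assms
proof (induction n_as arbitrary: i j)
  case (Cons na n_as)
  obtain k e where na: "na = (k, e)" by force
  let ?m = "sum_list (map fst n_as)"
  have eq: "jordan_matrix (na # n_as) =
      four_block_mat (jordan_block k e) (0\<^sub>m k ?m) (0\<^sub>m ?m k) (jordan_matrix n_as)"
    unfolding jordan_matrix_def na by (simp add: Let_def jordan_matrix_def[symmetric])
  show ?case
  proof (cases "i < k \<and> j < k \<or> \<not> i < k \<and> \<not> j < k")
    case True
    then show ?thesis
    proof
      assume "i < k \<and> j < k"
      then show ?thesis using Cons.prems unfolding eq by (auto split: if_splits)
    next
      assume ge: "\<not> i < k \<and> \<not> j < k"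
      define i' j' where "i' = i - k" and "j' = j - k"
      have ij: "i = k + i'" "j = k + j'" using ge by (auto simp: i'_def j'_def)
      have "i' < ?m" "j' < ?m" "jordan_matrix n_as $$ (i', j') \<noteq> 0"
        using Cons.prems unfolding eq by (auto simp: na ij)
      from Cons.IH[OF this] show ?thesis
        using \<open>i' < ?m\<close> \<open>j' < ?m\<close> unfolding eq by (auto simp: ij)
    qed
  next
    case False
    then show ?thesis using Cons.prems unfolding eq by (auto simp: na split: if_splits)
  qed
qed simp

text \<open>A superdiagonal entry of the Jordan form would produce a generalized eigenvector that is
  no eigenvector, which normality excludes. So \<open>J\<close> is diagonal, and each column of
  \<open>P\<close> is an eigenvector of \<open>A\<close> and, for the conjugate eigenvalue, of the
  adjoint.\<close>

lemma normal_diagonalization: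
  fixes A :: "complex mat"
  assumes A: "A \<in> carrier_mat n n" and normal: "A * mat_adjoint A = mat_adjoint A * A"
  obtains P Q J where "P \<in> carrier_mat n n" "Q \<in> carrier_mat n n" "J \<in> carrier_mat n n"
    "Q * P = 1\<^sub>m n" "P * Q = 1\<^sub>m n" "diagonal_mat J" "A = P * J * Q"
    "mat_adjoint A = P * mat_adjoint J * Q"
proof -
  let ?A' = "mat_adjoint A"
  obtain n_as where jnf: "jordan_nf A n_as"
  proof -
    obtain es where es: "mset es = proots (char_poly A)" using ex_mset by blast
    have "char_poly A = (\<Prod>x\<in>#mset es. [:- x, 1:])"
      using complex_poly_decompose_multiset[of "char_poly A"] degree_monic_char_poly[OF A]
      unfolding es by simp
    then have "char_poly A = (\<Prod>a\<leftarrow>es. [:- a, 1:])"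
      by (simp only: mset_map[symmetric] prod_mset_prod_list)
    then show ?thesis using jordan_nf_exists[OF A] that by blast
  qed
  define J where "J = jordan_matrix n_as"
  obtain P Q where wit: "similar_mat_wit A J P Q"
    using jnf unfolding jordan_nf_def similar_mat_def J_def by blast
  note w = similar_mat_witD2[OF A wit]
  have J: "J \<in> carrier_mat n n" and P: "P \<in> carrier_mat n n" and Q: "Q \<in> carrier_mat n n"
    and PQ: "P * Q = 1\<^sub>m n" and QP: "Q * P = 1\<^sub>m n" and AP: "A = P * J * Q"
    using w by auto
  have dim: "sum_list (map fst n_as) = n" using J unfolding J_def by auto
  have bidiag: "c = r \<or> c = Suc r \<and> J $$ (r, r) = J $$ (c, c)"
    if "r < n" "c < n" "J $$ (r, c) \<noteq> 0" for r c
    using jordan_matrix_bidiagonal[of r n_as c] that unfolding J_def dim by auto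
  have A': "?A' \<in> carrier_mat n n" using A by auto
  \<comment> \<open>Columns of \<open>P\<close> are kept as \<open>n\<close> by 1 matrices, so that
    adjoints and associativity of matrix products apply to them directly.\<close>
  define p where "p c = Matrix.mat n 1 (\<lambda>(r, _). P $$ (r, c))" for c
  have p [simp]: "p c \<in> carrier_mat n 1" for c unfolding p_def by auto
  have APJ: "A * P = P * J"
  proof -
    have "A * P = P * J * (Q * P)" unfolding AP
      using P J Q by (intro assoc_mult_mat[of _ n n]) auto
    then show ?thesis using QP P J by simp
  qed
  have mult_p: "(C * p c) $$ (r, 0) = (C * P) $$ (r, c)" if "C \<in> carrier_mat n n" "r < n" "c < n" for C r c
    using that by (simp only: index_mult_mat_sum[OF _ p] index_mult_mat_sum[OF _ P] zero_less_one) (simp add: p_def)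
  have A_p: "(A * p c) $$ (r, 0) = (\<Sum>l<n. P $$ (r, l) * J $$ (l, c))" if "r < n" "c < n" for r c
    using that by (simp only: mult_p[OF A] APJ index_mult_mat_sum[OF P J])
  have p_neq_0: "p c \<noteq> 0\<^sub>m n 1" if "c < n" for c
  proof
    assume 0: "p c = 0\<^sub>m n 1"
    have "(Q * p c) $$ (c, 0) = 1" using mult_p[OF Q that that] QP that by simp
    moreover have "Q * p c = 0\<^sub>m n 1" unfolding 0 by (rule right_mult_zero_mat[OF Q])
    ultimately show False using that by simp
  qed
  define M where "M e = A - e \<cdot>\<^sub>m 1\<^sub>m n" for e
  have M: "M e \<in> carrier_mat n n" for e using A unfolding M_def by auto
  have Mp: "(M e * p c) $$ (r, 0) = (\<Sum>l<n. P $$ (r, l) * J $$ (l, c)) - e * P $$ (r, c)"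
    if "r < n" "c < n" for e r c
  proof -
    have "M e * p c = A * p c - e \<cdot>\<^sub>m p c" unfolding M_def
      by (rule minus_smult_one_mult[OF A p])
    then show ?thesis using that A_p[OF that] A by (simp add: p_def)
  qed
  \<comment> \<open>If column \<open>c\<close> of \<open>J\<close> has only its diagonal entry, then
    \<open>p c\<close> is an eigenvector of \<open>A\<close>, and the kernel lemma carries it over
    to the adjoint.\<close>
  have adj_p: "mat_adjoint (M (J $$ (c, c))) * p c = 0\<^sub>m n 1"
    if c: "c < n" and z: "\<And>r. r < n \<Longrightarrow> r \<noteq> c \<Longrightarrow> J $$ (r, c) = 0" for c
  proof (rule normal_adjoint_kernel[OF M p])
    show "M (J $$ (c, c)) * mat_adjoint (M (J $$ (c, c))) = mat_adjoint (M (J $$ (c, c))) * M (J $$ (c, c))"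
      unfolding M_def by (rule normal_shift(2)[OF A normal])
    show "M (J $$ (c, c)) * p c = 0\<^sub>m n 1"
    proof (rule eq_matI)
      fix r j assume rj: "r < dim_row (0\<^sub>m n 1)" "j < dim_col (0\<^sub>m n 1)"
      have "(\<Sum>l<n. P $$ (r, l) * J $$ (l, c)) = (\<Sum>l<n. if l = c then P $$ (r, c) * J $$ (c, c) else 0)"
        using z by (intro sum.cong) auto
      then show "(M (J $$ (c, c)) * p c) $$ (r, j) = 0\<^sub>m n 1 $$ (r, j)"
        using rj c by (simp add: Mp)
    qed (use M p in \<open>auto simp: p_def\<close>)
  qed
  have diag: "J $$ (r, c) = 0" if "r < n" "c < n" "r \<noteq> c" for r c
  proof (rule ccontr)
    assume "J $$ (r, c) \<noteq> 0"
    then have ex: "Suc r < n \<and> J $$ (r, Suc r) \<noteq> 0" using bidiag[of r c] that by auto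
    \<comment> \<open>Leastness keeps column \<open>i\<close> of \<open>J\<close> free of
      off-diagonal entries: a nonzero one could only sit in row \<open>i - 1\<close> and would give
      a smaller index. So \<open>p i\<close> is a true eigenvector, while \<open>M ?e\<close> sends
      \<open>p (Suc i)\<close> to a nonzero multiple of it.\<close>
    define i where "i = (LEAST i. Suc i < n \<and> J $$ (i, Suc i) \<noteq> 0)"
    have i: "Suc i < n" "J $$ (i, Suc i) \<noteq> 0"
      using LeastI[of "\<lambda>i. Suc i < n \<and> J $$ (i, Suc i) \<noteq> 0", OF ex] unfolding i_def by auto
    have min: "J $$ (l, i) = 0" if "l < n" "l \<noteq> i" for l
    proof (rule ccontr)
      assume nz: "J $$ (l, i) \<noteq> 0"
      then have "i = Suc l" using bidiag[of l i] that i by auto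
      then show False using not_less_Least[of l "\<lambda>i. Suc i < n \<and> J $$ (i, Suc i) \<noteq> 0"] nz i
        unfolding i_def[symmetric] by auto
    qed
    let ?e = "J $$ (i, i)" and ?d = "J $$ (i, Suc i)"
    have e: "J $$ (Suc i, Suc i) = ?e" using bidiag[of i "Suc i"] i by auto
    have "M ?e * p (Suc i) = ?d \<cdot>\<^sub>m p i"
    proof (rule eq_matI)
      fix r j assume "r < dim_row (?d \<cdot>\<^sub>m p i)" "j < dim_col (?d \<cdot>\<^sub>m p i)"
      then have rj: "r < n" "j = 0" by (auto simp: p_def)
      have "(\<Sum>l<n. P $$ (r, l) * J $$ (l, Suc i)) =
          (\<Sum>l\<in>{i, Suc i}. P $$ (r, l) * J $$ (l, Suc i))"
        using i bidiag[of _ "Suc i"] by (intro sum.mono_neutral_right) auto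
      then show "(M ?e * p (Suc i)) $$ (r, j) = (?d \<cdot>\<^sub>m p i) $$ (r, j)"
        using rj i e by (simp add: Mp) (simp add: p_def)
    qed (use M p in \<open>auto simp: p_def\<close>)
    \<comment> \<open>\<open>M ?e\<close> is moved to the other side of the inner product, where its
      adjoint annihilates \<open>p i\<close>; so \<open>?d\<close> times the squared norm of
      \<open>p i\<close> is 0.\<close>
    then have "mat_adjoint (p i) * (?d \<cdot>\<^sub>m p i) = mat_adjoint (p i) * (M ?e * p (Suc i))" by simp
    also have "\<dots> = (mat_adjoint (p i) * M ?e) * p (Suc i)"
      by (rule assoc_mult_mat[symmetric, OF mat_adjoint_carrier[OF p] M p])
    also have "mat_adjoint (p i) * M ?e = mat_adjoint (mat_adjoint (M ?e) * p i)"
      by (subst mat_adjoint_mult[OF mat_adjoint_carrier[OF M] p]) simp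
    also have "\<dots> = 0\<^sub>m 1 n" using adj_p[OF _ min] i by (intro eq_matI) auto
    finally have "?d \<cdot>\<^sub>m (mat_adjoint (p i) * p i) = 0\<^sub>m 1 1"
      by (simp add: mult_smult_distrib[OF mat_adjoint_carrier[OF p] p] left_mult_zero_mat[OF p])
    then have "mat_adjoint (p i) * p i = 0\<^sub>m 1 1"
    proof (intro eq_matI)
      fix r j assume "r < dim_row (0\<^sub>m 1 1 :: complex mat)" "j < dim_col (0\<^sub>m 1 1 :: complex mat)"
      then have rj: "r = 0" "j = 0" by auto
      have "(?d \<cdot>\<^sub>m (mat_adjoint (p i) * p i)) $$ (0, 0) = 0"
        unfolding \<open>?d \<cdot>\<^sub>m (mat_adjoint (p i) * p i) = 0\<^sub>m 1 1\<close> by simp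
      then have "?d * (mat_adjoint (p i) * p i) $$ (0, 0) = 0"
        by (subst (asm) index_smult_mat(1)) (simp_all add: p_def)
      then show "(mat_adjoint (p i) * p i) $$ (r, j) = 0\<^sub>m 1 1 $$ (r, j)" using i rj by simp
    qed (simp_all add: p_def)
    then have "p i = 0\<^sub>m n 1" by (intro adjoint_mult_self_eq_0[OF p]) auto
    then show False using p_neq_0 i by auto
  qed
  have adjJ: "mat_adjoint J \<in> carrier_mat n n" using J by auto
  have "?A' * P = P * mat_adjoint J"
  proof (rule eq_matI)
    fix r c assume "r < dim_row (P * mat_adjoint J)" "c < dim_col (P * mat_adjoint J)"
    then have rc: "r < n" "c < n" using P J by auto
    let ?e = "J $$ (c, c)"
    have "mat_adjoint (M ?e) * p c = ?A' * p c - cnj ?e \<cdot>\<^sub>m p c"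
      unfolding M_def normal_shift(1)[OF A normal]
      by (rule minus_smult_one_mult[OF A' p])
    moreover have "mat_adjoint (M ?e) * p c = 0\<^sub>m n 1" using adj_p[OF rc(2)] diag rc(2) by blast
    ultimately have eq: "?A' * p c - cnj ?e \<cdot>\<^sub>m p c = 0\<^sub>m n 1" by simp
    have "(?A' * p c - cnj ?e \<cdot>\<^sub>m p c) $$ (r, 0) = 0" unfolding eq using rc by simp
    then have "(?A' * P) $$ (r, c) = cnj ?e * P $$ (r, c)"
      using rc A' mult_p[OF A' rc] by (auto simp: p_def)
    also have "\<dots> = (\<Sum>l<n. if l = c then cnj ?e * P $$ (r, c) else 0)" using rc by simp
    also have "\<dots> = (P * mat_adjoint J) $$ (r, c)"
      unfolding index_mult_mat_sum[OF P adjJ rc]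
      using J rc diag by (intro sum.cong) auto
    finally show "(?A' * P) $$ (r, c) = (P * mat_adjoint J) $$ (r, c)" .
  qed (use A' P J in auto)
  then have "P * mat_adjoint J * Q = ?A' * P * Q" by simp
  also have "\<dots> = ?A' * (P * Q)" by (rule assoc_mult_mat[OF A' P Q])
  finally have "P * mat_adjoint J * Q = ?A' * (P * Q)" .
  then have "mat_adjoint A = P * mat_adjoint J * Q" using PQ right_mult_one_mat[OF A'] by simp
  moreover have "diagonal_mat J" using diag J unfolding diagonal_mat_def by auto
  ultimately show ?thesis using that P Q J QP PQ AP by blast
qed

section \<open>Traces of words in a normal matrix and its adjoint\<close>

lemma trace_mult_commute:
  fixes X Y :: "'a :: comm_semiring_0 mat"
  assumes X: "X \<in> carrier_mat n m" and Y: "Y \<in> carrier_mat m n"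
  shows "(\<Sum>i<n. (X * Y) $$ (i, i)) = (\<Sum>i<m. (Y * X) $$ (i, i))"
proof -
  have "(\<Sum>i<n. (X * Y) $$ (i, i)) = (\<Sum>i<n. \<Sum>l<m. X $$ (i, l) * Y $$ (l, i))"
    by (intro sum.cong refl index_mult_mat_sum[OF X Y]) auto
  also have "\<dots> = (\<Sum>l<m. \<Sum>i<n. Y $$ (l, i) * X $$ (i, l))"
    by (subst sum.swap) (simp add: mult.commute)
  also have "\<dots> = (\<Sum>i<m. (Y * X) $$ (i, i))"
    by (intro sum.cong refl index_mult_mat_sum[OF Y X, symmetric]) auto
  finally show ?thesis .
qed

lemma diagonal_mat_mult_index:
  fixes X Y :: "'a :: semiring_0 mat"
  assumes X: "X \<in> carrier_mat n n" and Y: "Y \<in> carrier_mat n n" "diagonal_mat Y" and "i < n" "j < n"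
  shows "(X * Y) $$ (i, j) = X $$ (i, j) * Y $$ (j, j)"
proof -
  have "(X * Y) $$ (i, j) = (\<Sum>l<n. if l = j then X $$ (i, j) * Y $$ (j, j) else 0)"
    unfolding index_mult_mat_sum[OF X Y(1) assms(4,5)]
    using Y assms(5) by (intro sum.cong) (auto simp: diagonal_mat_def)
  then show ?thesis using assms(5) by simp
qed

lemma diagonal_mat_pow_index:
  fixes J :: "'a :: comm_semiring_1 mat"
  assumes J: "J \<in> carrier_mat n n" "diagonal_mat J" and "i < n" "j < n"
  shows "(J ^\<^sub>m k) $$ (i, j) = (if i = j then J $$ (i, i) ^ k else 0)"
proof (induction k)
  case 0
  then show ?case using assms by auto
next
  case (Suc k)
  have "(J ^\<^sub>m Suc k) $$ (i, j) = (J ^\<^sub>m k) $$ (i, j) * J $$ (j, j)"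
    unfolding pow_mat.simps by (intro diagonal_mat_mult_index) (use assms in auto)
  then show ?case using Suc by (simp add: mult.commute)
qed

lemma similar_pow:
  assumes "P \<in> carrier_mat n n" "Q \<in> carrier_mat n n" "J \<in> carrier_mat n n"
    and "Q * P = 1\<^sub>m n" "P * Q = 1\<^sub>m n" "A = P * J * Q"
  shows "A ^\<^sub>m k = P * J ^\<^sub>m k * Q"
proof -
  have "similar_mat_wit A J P Q" by (rule similar_mat_witI[of _ _ n]) (use assms in auto)
  then show ?thesis using similar_mat_wit_pow_id by blast
qed

lemma proots_prod_linear:
  "proots (\<Prod>e\<leftarrow>es. [:- e, 1:]) = mset (es :: 'a :: idom list)"
proof (induction es)
  case (Cons e es)
  have "(\<Prod>e\<leftarrow>es. [:- e, 1:]) \<noteq> 0" by (auto simp: prod_list_zero_iff)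
  then show ?case using Cons by (simp add: proots_mult del: mult_pCons_left)
qed simp

text \<open>In the joint eigenbasis the word becomes diagonal, cyclicity of the trace removes
  \<open>P\<close> and \<open>Q\<close>, and similarity identifies the diagonal of \<open>J\<close>
  with the roots of the characteristic polynomial, multiplicities included.\<close>

lemma trace_fun_monomial:
  assumes A: "A \<in> carrier_mat n n" and normal: "normal_mat A"
  shows "trace_fun (\<lambda>z. z ^ p * cnj z ^ q) A = (\<Sum>i<n. (A ^\<^sub>m p * mat_adjoint A ^\<^sub>m q) $$ (i, i))"
proof -
  have "A * mat_adjoint A = mat_adjoint A * A" using normal unfolding normal_mat_def by auto
  then obtain P Q J where P: "P \<in> carrier_mat n n" and Q: "Q \<in> carrier_mat n n"
    and J: "J \<in> carrier_mat n n" and QP: "Q * P = 1\<^sub>m n" and PQ: "P * Q = 1\<^sub>m n"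
    and diag: "diagonal_mat J" and AJ: "A = P * J * Q" and AJ': "mat_adjoint A = P * mat_adjoint J * Q"
    by (rule normal_diagonalization[OF A])
  let ?K = "mat_adjoint J"
  have K: "?K \<in> carrier_mat n n" "diagonal_mat ?K" using J diag unfolding diagonal_mat_def by auto
  let ?L = "J ^\<^sub>m p * ?K ^\<^sub>m q"
  have Jp: "J ^\<^sub>m p \<in> carrier_mat n n" and Kq: "?K ^\<^sub>m q \<in> carrier_mat n n" using J K by auto
  have L: "?L \<in> carrier_mat n n" using Jp Kq by auto
  have "A ^\<^sub>m p * mat_adjoint A ^\<^sub>m q = (P * J ^\<^sub>m p * Q) * (P * ?K ^\<^sub>m q * Q)"
    using similar_pow[OF P Q J QP PQ AJ] similar_pow[OF P Q K(1) QP PQ AJ'] by simp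
  also have "\<dots> = P * (J ^\<^sub>m p * (Q * (P * (?K ^\<^sub>m q * Q))))"
    using P Q Jp Kq by (simp add: assoc_mult_mat[of _ n n _ n _ n])
  also have "Q * (P * (?K ^\<^sub>m q * Q)) = (Q * P) * (?K ^\<^sub>m q * Q)"
    using P Q Kq by (simp add: assoc_mult_mat[of _ n n _ n _ n])
  also have "\<dots> = ?K ^\<^sub>m q * Q" unfolding QP using Q Kq by (simp add: left_mult_one_mat[of _ n n])
  also have "P * (J ^\<^sub>m p * (?K ^\<^sub>m q * Q)) = P * (?L * Q)"
    using P Q Jp Kq by (simp add: assoc_mult_mat[of _ n n _ n _ n])
  finally have "(\<Sum>i<n. (A ^\<^sub>m p * mat_adjoint A ^\<^sub>m q) $$ (i, i)) = (\<Sum>i<n. (?L * Q * P) $$ (i, i))"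
    using trace_mult_commute[of P n n "?L * Q"] P L Q by simp
  also have "?L * Q * P = ?L"
    using P Q L by (simp add: assoc_mult_mat[of _ n n _ n _ n] QP right_mult_one_mat[OF L])
  also have "(\<Sum>i<n. ?L $$ (i, i)) = (\<Sum>i<n. J $$ (i, i) ^ p * cnj (J $$ (i, i)) ^ q)"
  proof (intro sum.cong refl)
    fix i assume "i \<in> {..<n}"
    then have i: "i < n" by simp
    have dK: "diagonal_mat (?K ^\<^sub>m q)"
      using K J diagonal_mat_pow_index[OF K] by (auto simp: diagonal_mat_def[of "?K ^\<^sub>m q"])
    show "?L $$ (i, i) = J $$ (i, i) ^ p * cnj (J $$ (i, i)) ^ q"
      using diagonal_mat_mult_index[OF Jp Kq dK i i] diagonal_mat_pow_index[OF J diag i i]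
        diagonal_mat_pow_index[OF K i i] J i by simp
  qed
  finally have trace: "(\<Sum>i<n. (A ^\<^sub>m p * mat_adjoint A ^\<^sub>m q) $$ (i, i)) =
      (\<Sum>i<n. J $$ (i, i) ^ p * cnj (J $$ (i, i)) ^ q)" .
  have "similar_mat A J" by (rule similar_matI[of _ _ P Q n]) (use A J P Q QP PQ AJ in auto)
  then have "char_poly A = char_poly J" by (rule char_poly_similar)
  also have "\<dots> = (\<Prod>e\<leftarrow>diag_mat J. [:- e, 1:])"
    using diag J by (intro char_poly_upper_triangular[OF J]) (auto simp: diagonal_mat_def)
  finally have "proots (char_poly A) = mset (diag_mat J)"
    by (simp add: proots_prod_linear)
  then show ?thesis unfolding trace_fun_def trace using J
    by (simp add: diag_mat_def image_mset.compositionality o_def sum_unfold_sum_mset lessThan_atLeast0)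
qed

text \<open>At a coordinate of maximal modulus of an eigenvector, the eigenvalue equation compares
  \<open>norm z\<close> with an absolute row sum, as in Gershgorin's theorem.\<close>

lemma norm_eigenvalue_le:
  fixes A :: "complex mat"
  assumes A: "A \<in> carrier_mat n n" and row: "\<And>i. i < n \<Longrightarrow> (\<Sum>j<n. norm (A $$ (i, j))) \<le> M"
    and z: "poly (char_poly A) z = 0"
  shows "norm z \<le> M"
proof -
  obtain v where v: "v \<in> carrier_vec n" "v \<noteq> 0\<^sub>v n" "A *\<^sub>v v = z \<cdot>\<^sub>v v"
    using z eigenvalue_root_char_poly[OF A, of z] A unfolding eigenvalue_def eigenvector_def by auto
  from v obtain l where l: "l < n" "vec_index v l \<noteq> 0" by (metis carrier_vecD eq_vecI index_zero_vec)
  define m where "m = Max ((\<lambda>i. norm (vec_index v i)) ` {..<n})"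
  have "m \<in> (\<lambda>i. norm (vec_index v i)) ` {..<n}" unfolding m_def using l by (intro Max_in) auto
  then obtain i where i: "i < n" "m = norm (vec_index v i)" by auto
  have le_m: "norm (vec_index v j) \<le> m" if "j < n" for j unfolding m_def using that by (intro Max_ge) auto
  have pos: "m > 0" using le_m[OF l(1)] l(2) by (smt (verit) zero_less_norm_iff)
  have "z * vec_index v i = vec_index (A *\<^sub>v v) i" using v i by simp
  also have "\<dots> = (\<Sum>j<n. A $$ (i, j) * vec_index v j)"
    using A v(1) i by (simp add: scalar_prod_def lessThan_atLeast0)
  finally have "norm z * m = norm (\<Sum>j<n. A $$ (i, j) * vec_index v j)" using i by (simp flip: norm_mult)
  also have "\<dots> \<le> (\<Sum>j<n. norm (A $$ (i, j)) * m)"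
    by (intro sum_norm_le) (auto simp: norm_mult intro!: mult_left_mono le_m)
  also have "\<dots> \<le> M * m" using row[OF i(1)] pos by (simp flip: sum_distrib_right)
  finally show ?thesis using pos by simp
qed

section \<open>Riemann integrable functions are continuous almost everywhere\<close>

text \<open>The tags stay arbitrary within the cells, because the oscillation argument compares two
  taggings of the same cells.\<close>

lemma uniform_tagged_division:
  fixes y :: "nat \<Rightarrow> real"
  assumes N: "N > 0" and y: "\<And>i. i < N \<Longrightarrow> y i \<in> {real i / real N..real (Suc i) / real N}"
  defines "D \<equiv> (\<lambda>i. (y i, {real i / real N..real (Suc i) / real N})) ` {..<N}"
  shows "D tagged_division_of {0..1}"
    and "\<And>x K. (x, K) \<in> D \<Longrightarrow> diameter K = 1 / real N"
    and "(\<Sum>(x, K)\<in>D. measure lborel K *\<^sub>R f x) = (\<Sum>i<N. (1 / real N) *\<^sub>R (f (y i) :: 'b :: real_normed_vector))"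
proof -
  let ?K = "\<lambda>i. {real i / real N..real (Suc i) / real N}"
  have len: "real (Suc i) / real N - real i / real N = 1 / real N" for i
    using N by (simp add: field_simps)
  have nonneg: "real i / real N \<le> real (Suc i) / real N" for i
    using N by (simp add: divide_right_mono)
  show "D tagged_division_of {0..1}"
  proof (rule tagged_division_ofI)
    show "finite D" unfolding D_def by simp
    fix x K assume "(x, K) \<in> D"
    then obtain i where i: "i < N" "x = y i" "K = ?K i" unfolding D_def by auto
    show "x \<in> K" using y i by simp
    have "real (Suc i) / real N \<le> 1" using i N by (simp add: divide_le_eq)
    then show "K \<subseteq> {0..1}" using i by auto
    show "\<exists>a b. K = cbox a b" using i by (metis cbox_interval)
  next
    fix x1 K1 x2 K2 assume *: "(x1, K1) \<in> D" "(x2, K2) \<in> D" "(x1, K1) \<noteq> (x2, K2)"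
    then obtain i j where i: "K1 = ?K i" "x1 = y i" and j: "K2 = ?K j" "x2 = y j"
      unfolding D_def by auto
    with * have "i \<noteq> j" by auto
    then have "Suc i \<le> j \<or> Suc j \<le> i" by auto
    then have "real (Suc i) / real N \<le> real j / real N \<or> real (Suc j) / real N \<le> real i / real N"
      using N by (auto simp: divide_le_cancel)
    then show "interior K1 \<inter> interior K2 = {}" unfolding i j by auto
  next
    show "\<Union>{K. \<exists>x. (x, K) \<in> D} = {0..1}"
    proof (intro equalityI subsetI)
      fix z assume "z \<in> \<Union>{K. \<exists>x. (x, K) \<in> D}"
      then obtain i where i: "i < N" "z \<in> ?K i" unfolding D_def by auto
      have "real (Suc i) / real N \<le> 1" using i N by (simp add: divide_le_eq)
      moreover have "0 \<le> real i / real N" by simp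
      ultimately show "z \<in> {0..1}" using i(2) by (meson atLeastAtMost_iff order_trans)
    next
      fix z :: real assume z: "z \<in> {0..1}"
      \<comment> \<open>The last cell takes in the endpoint 1, for which the floor would give the
        index \<open>N\<close>.\<close>
      define i where "i = (if z = 1 then N - 1 else nat \<lfloor>z * N\<rfloor>)"
      have "i < N \<and> z \<in> ?K i"
      proof (cases "z = 1")
        case True
        then show ?thesis using N by (auto simp: i_def field_simps)
      next
        case False
        with z have z': "0 \<le> z" "z < 1" by auto
        have "z * N < N" using z' N by simp
        then have "\<lfloor>z * N\<rfloor> < int N" by (simp add: floor_less_iff)
        moreover have "real i = of_int \<lfloor>z * N\<rfloor>" using z' False by (simp add: i_def)
        ultimately show ?thesis
          using N z' False by (auto simp: field_simps i_def) linarith+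
      qed
      then show "z \<in> \<Union>{K. \<exists>x. (x, K) \<in> D}" unfolding D_def by blast
    qed
  qed
  show "diameter K = 1 / real N" if "(x, K) \<in> D" for x K
    using that len nonneg unfolding D_def by (auto simp: not_less)
  \<comment> \<open>Different indices give different cells, so no terms merge when the sum over the
    set \<open>D\<close> is written as a sum over \<open>i\<close>.\<close>
  have "inj_on (\<lambda>i. (y i, ?K i)) {..<N}"
  proof (rule inj_onI)
    fix i j assume "(y i, ?K i) = (y j, ?K j)"
    then have "?K i = ?K j" by simp
    then have "real i / real N = real j / real N"
      using nonneg by (simp only: Icc_eq_Icc) auto
    then show "i = j" using N by simp
  qed
  then show "(\<Sum>(x, K)\<in>D. measure lborel K *\<^sub>R f x) = (\<Sum>i<N. (1 / real N) *\<^sub>R f (y i))"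
    unfolding D_def using len nonneg by (subst sum.reindex) auto
qed

lemma riemann_integrable_on_comp:
  fixes f :: "real \<Rightarrow> 'b :: real_normed_vector" and h :: "'b \<Rightarrow> 'c :: real_normed_vector"
  assumes f: "f riemann_integrable_on S" and h: "bounded_linear h"
  shows "(\<lambda>x. h (f x)) riemann_integrable_on S"
proof -
  interpret h: bounded_linear h by fact
  obtain B where B: "B > 0" "\<And>x. norm (h x) \<le> norm x * B" using h.pos_bounded by auto
  obtain I where I: "\<And>e. e > 0 \<Longrightarrow> \<exists>d>0. \<forall>D. D tagged_division_of S \<and> (\<forall>(x, K) \<in> D. diameter K < d)
        \<longrightarrow> norm ((\<Sum>(x, K) \<in> D. measure lborel K *\<^sub>R f x) - I) < e"
    using f unfolding riemann_integrable_on_def by blast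
  show ?thesis unfolding riemann_integrable_on_def
  proof (rule exI[of _ "h I"], intro allI impI)
    fix e :: real assume "e > 0"
    then have "e / B > 0" using B by simp
    from I[OF this] obtain d where d: "d > 0" "\<And>D. D tagged_division_of S \<and> (\<forall>(x, K) \<in> D. diameter K < d)
        \<Longrightarrow> norm ((\<Sum>(x, K) \<in> D. measure lborel K *\<^sub>R f x) - I) < e / B" by blast
    show "\<exists>d>0. \<forall>D. D tagged_division_of S \<and> (\<forall>(x, K) \<in> D. diameter K < d)
        \<longrightarrow> norm ((\<Sum>(x, K) \<in> D. measure lborel K *\<^sub>R h (f x)) - h I) < e"
    proof (intro exI[of _ d] conjI allI impI)
      fix D assume D: "D tagged_division_of S \<and> (\<forall>(x, K) \<in> D. diameter K < d)"
      have "(\<Sum>(x, K) \<in> D. measure lborel K *\<^sub>R h (f x)) - h I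
          = h ((\<Sum>(x, K) \<in> D. measure lborel K *\<^sub>R f x) - I)"
        by (simp add: h.diff h.sum h.scaleR case_prod_beta)
      also have "norm \<dots> \<le> norm ((\<Sum>(x, K) \<in> D. measure lborel K *\<^sub>R f x) - I) * B" by (rule B)
      also have "\<dots> < e / B * B" using d(2)[OF D] B by (intro mult_strict_right_mono)
      finally show "norm ((\<Sum>(x, K) \<in> D. measure lborel K *\<^sub>R h (f x)) - h I) < e" using B by simp
    qed (rule d)
  qed
qed

text \<open>Tagging the cells of a fine uniform partition by pairs of points at which the function differs
  by more than \<open>e\<close> changes the Riemann sum by at least \<open>e\<close> times the total length of the
  cells that admit such a pair; hence this length is small.\<close>

lemma riemann_integrable_oscillation_negligible:
  fixes g :: "real \<Rightarrow> real"
  assumes g: "g riemann_integrable_on {0..1}" and e: "e > 0"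
  shows "negligible {x\<in>{0..1}. \<forall>r>0. \<exists>y\<in>{0..1}. \<exists>z\<in>{0..1}. \<bar>y - x\<bar> < r \<and> \<bar>z - x\<bar> < r \<and> g y - g z > e}"
    (is "negligible ?E")
  unfolding negligible_outer_le
proof (intro allI impI)
  fix \<epsilon> :: real assume \<epsilon>: "\<epsilon> > 0"
  obtain I where I: "\<And>\<epsilon>. \<epsilon> > 0 \<Longrightarrow> \<exists>d>0. \<forall>D. D tagged_division_of {0..1} \<and> (\<forall>(x, K) \<in> D. diameter K < d)
        \<longrightarrow> norm ((\<Sum>(x, K) \<in> D. measure lborel K *\<^sub>R g x) - I) < \<epsilon>"
    using g unfolding riemann_integrable_on_def by blast
  \<comment> \<open>Two Riemann sums this close to \<open>I\<close> differ by at most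
    \<open>\<epsilon> * e\<close>, while each bad cell adds at least \<open>e / real N\<close> to
    the difference; dividing by \<open>e\<close> bounds the total length of the bad cells by
    \<open>\<epsilon>\<close>.\<close>
  have "\<epsilon> * e / 2 > 0" using \<epsilon> e by simp
  from I[OF this] obtain d where d: "d > 0" "\<And>D. D tagged_division_of {0..1} \<and> (\<forall>(x, K) \<in> D. diameter K < d)
        \<Longrightarrow> norm ((\<Sum>(x, K) \<in> D. measure lborel K *\<^sub>R g x) - I) < \<epsilon> * e / 2" by blast
  obtain N where N: "N > 0" "1 / real N < d"
    using d(1) real_arch_inverse[of d] by (auto simp: inverse_eq_divide)
  let ?K = "\<lambda>i. {real i / real N..real (Suc i) / real N}"
  define bad where "bad i \<longleftrightarrow> (\<exists>y\<in>?K i. \<exists>z\<in>?K i. g y - g z > e)" for i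
  have "\<forall>i. \<exists>w. fst w \<in> ?K i \<and> snd w \<in> ?K i \<and> (if bad i then e else 0) \<le> g (fst w) - g (snd w)"
  proof
    fix i show "\<exists>w. fst w \<in> ?K i \<and> snd w \<in> ?K i \<and> (if bad i then e else 0) \<le> g (fst w) - g (snd w)"
    proof (cases "bad i")
      case True
      then obtain y z where "y \<in> ?K i" "z \<in> ?K i" "g y - g z > e" unfolding bad_def by blast
      then show ?thesis using True by (intro exI[of _ "(y, z)"]) auto
    next
      case False
      have "real i / real N \<in> ?K i" using N by (simp add: divide_right_mono)
      then show ?thesis using False by (intro exI[of _ "(real i / real N, real i / real N)"]) auto
    qed
  qed
  from choice[OF this] obtain w where w: "\<forall>i. fst (w i) \<in> ?K i \<and> snd (w i) \<in> ?K i \<and>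
    (if bad i then e else 0) \<le> g (fst (w i)) - g (snd (w i))" ..
  define y z where "y i = fst (w i)" and "z i = snd (w i)" for i
  have yz: "y i \<in> ?K i" "z i \<in> ?K i" "(if bad i then e else 0) \<le> g (y i) - g (z i)" for i
    using w unfolding y_def z_def by blast+
  define B where "B = {i. i < N \<and> bad i}"
  have [simp]: "finite B" unfolding B_def by simp
  have sum_close: "norm ((\<Sum>i<N. (1 / real N) *\<^sub>R g (w i)) - I) < \<epsilon> * e / 2"
    if "\<And>i. w i \<in> ?K i" for w
  proof -
    note U = uniform_tagged_division[OF N(1), of w, OF that]
    have "\<forall>(x, K) \<in> (\<lambda>i. (w i, ?K i)) ` {..<N}. diameter K < d"
    proof (intro ballI, unfold case_prod_unfold)
      fix xK assume "xK \<in> (\<lambda>i. (w i, ?K i)) ` {..<N}"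
      then show "diameter (snd xK) < d" using U(2)[of "fst xK" "snd xK"] N(2) by simp
    qed
    from d(2)[OF conjI[OF U(1) this]] show ?thesis unfolding U(3) .
  qed
  have "(\<Sum>i<N. (if bad i then e else 0) / real N) \<le> (\<Sum>i<N. (g (y i) - g (z i)) / real N)"
    by (intro sum_mono divide_right_mono yz(3)) auto
  also have "\<dots> = (\<Sum>i<N. (1 / real N) *\<^sub>R g (y i)) - (\<Sum>i<N. (1 / real N) *\<^sub>R g (z i))"
    by (simp add: sum_subtractf diff_divide_distrib)
  also have "\<dots> \<le> \<epsilon> * e" using sum_close[of y, OF yz(1)] sum_close[of z, OF yz(2)] unfolding real_norm_def by linarith
  also have "(\<Sum>i<N. (if bad i then e else 0) / real N) = (\<Sum>i\<in>B. e / real N)"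
    unfolding B_def by (rule sum.mono_neutral_cong_right) auto
  finally have "e * (real (card B) / real N) \<le> e * \<epsilon>" by (simp add: mult.commute)
  then have card: "real (card B) / real N \<le> \<epsilon>"
    using e mult_le_cancel_left_pos by blast
  \<comment> \<open>Grid points are added because a neighbourhood of one may meet two cells, so that
    neither of them need be bad; being finitely many, they cost no measure.\<close>
  define T where "T = (\<Union>i\<in>B. ?K i) \<union> (\<lambda>i. real i / real N) ` {..N}"
  have fin: "finite ((\<lambda>i. real i / real N) ` {..N})" by simp
  have fin_sets: "(\<lambda>i. real i / real N) ` {..N} \<in> sets lebesgue"
    by (intro negligible_imp_sets negligible_finite fin)
  have K: "?K i \<in> lmeasurable" "measure lebesgue (?K i) = 1 / real N" for i
    using N by (auto simp: field_simps)
  have "?E \<subseteq> T"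
  proof
    fix x assume x: "x \<in> ?E"
    show "x \<in> T"
    proof (cases "x \<in> (\<lambda>i. real i / real N) ` {..N}")
      case False
      have "x \<noteq> 1" using False N by (auto simp: image_iff)
      with x have x': "0 \<le> x" "x < 1" by auto
      define i where "i = nat \<lfloor>x * N\<rfloor>"
      have "x * N < N" using x' N by simp
      then have "\<lfloor>x * N\<rfloor> < int N" by (simp add: floor_less_iff)
      moreover have ri: "real i = of_int \<lfloor>x * N\<rfloor>" using x' by (simp add: i_def)
      ultimately have iN: "i < N" by linarith
      have "real i \<le> x * N" "x * N < real i + 1" unfolding ri by linarith+
      then have le: "real i / real N \<le> x" "x < real (Suc i) / real N"
        using N by (auto simp: field_simps)
      have "real i / real N \<noteq> x" using False iN by (auto simp: image_iff)
      with le have le': "real i / real N < x" by simp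
      define r where "r = min (x - real i / real N) (real (Suc i) / real N - x)"
      have "r > 0" using le le' by (simp add: r_def)
      with x obtain y z where "\<bar>y - x\<bar> < r" "\<bar>z - x\<bar> < r" "g y - g z > e" by blast
      moreover from this have "y \<in> ?K i" "z \<in> ?K i" unfolding r_def by auto
      ultimately have "i \<in> B" using iN unfolding B_def bad_def by blast
      then show ?thesis using le unfolding T_def by force
    qed (simp add: T_def)
  qed
  moreover have "T \<in> lmeasurable" unfolding T_def
    using K fin by (intro fmeasurable.Un fmeasurable.finite_UN) (auto intro: negligible_imp_measurable negligible_finite)
  moreover have "measure lebesgue T \<le> \<epsilon>"
  proof -
    have "measure lebesgue T \<le> measure lebesgue (\<Union>i\<in>B. ?K i) + measure lebesgue ((\<lambda>i. real i / real N) ` {..N})"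
      unfolding T_def using fin_sets by (intro measure_Un_le sets.finite_UN) auto
    also have "measure lebesgue ((\<lambda>i. real i / real N) ` {..N}) = 0"
      by (intro negligible_imp_measure0 negligible_finite fin)
    also have "measure lebesgue (\<Union>i\<in>B. ?K i) \<le> (\<Sum>i\<in>B. measure lebesgue (?K i))"
      by (intro measure_UNION_le) auto
    also have "\<dots> = real (card B) / real N" unfolding K by simp
    finally show ?thesis using card by simp
  qed
  ultimately show "\<exists>T. ?E \<subseteq> T \<and> T \<in> lmeasurable \<and> measure lebesgue T \<le> \<epsilon>" by blast
qed

text \<open>At a discontinuity the oscillation exceeds some threshold \<open>1 / (n + 1)\<close>, so
  countably many null sets cover the exceptional points. Exchanging \<open>y\<close> and
  \<open>z\<close> lets the one-sided inequality control both signs.\<close>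

lemma riemann_integrable_negligible_discontinuities_real:
  fixes g :: "real \<Rightarrow> real"
  assumes g: "g riemann_integrable_on {0..1}"
  shows "\<exists>Z. negligible Z \<and> (\<forall>x\<in>{0..1} - Z. continuous (at x within {0..1}) g)"
proof (intro exI conjI ballI)
  define E where "E n = {x\<in>{0..1}. \<forall>r>0. \<exists>y\<in>{0..1}. \<exists>z\<in>{0..1}. \<bar>y - x\<bar> < r \<and> \<bar>z - x\<bar> < r \<and>
    g y - g z > inverse (real (Suc n))}" for n
  show "negligible (\<Union>n. E n)"
    unfolding E_def
    by (intro negligible_Union_nat riemann_integrable_oscillation_negligible[OF g]) simp
  fix x assume x: "x \<in> {0..1} - (\<Union>n. E n)"
  show "continuous (at x within {0..1}) g"
    unfolding continuous_within_eps_delta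
  proof (intro allI impI)
    fix e :: real assume "e > 0"
    then obtain n where n: "inverse (real (Suc n)) < e" using reals_Archimedean by blast
    from x have "x \<notin> E n" "x \<in> {0..1}" by auto
    then obtain r where r: "r > 0" and no: "\<not> (\<exists>y\<in>{0..1}. \<exists>z\<in>{0..1}.
        \<bar>y - x\<bar> < r \<and> \<bar>z - x\<bar> < r \<and> g y - g z > inverse (real (Suc n)))"
      unfolding E_def by blast
    have osc: "g y - g z \<le> inverse (real (Suc n))"
      if "y \<in> {0..1}" "z \<in> {0..1}" "\<bar>y - x\<bar> < r" "\<bar>z - x\<bar> < r" for y z
      using no that by (meson not_le)
    show "\<exists>d>0. \<forall>x'\<in>{0..1}. dist x' x < d \<longrightarrow> dist (g x') (g x) < e"
    proof (intro exI[of _ r] conjI ballI impI)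
      fix x' assume x': "x' \<in> {0..1}" "dist x' x < r"
      have "g x' - g x \<le> inverse (real (Suc n))" "g x - g x' \<le> inverse (real (Suc n))"
        using osc[of x' x] osc[of x x'] r x' \<open>x \<in> {0..1}\<close> unfolding dist_real_def by auto
      then show "dist (g x') (g x) < e" using n unfolding dist_real_def by linarith
    qed (rule r)
  qed
qed

lemma riemann_integrable_negligible_discontinuities:
  fixes f :: "real \<Rightarrow> 'b :: euclidean_space"
  assumes f: "f riemann_integrable_on {0..1}"
  shows "\<exists>Z. negligible Z \<and> (\<forall>x\<in>{0..1} - Z. continuous (at x within {0..1}) f)"
proof -
  let ?P = "\<lambda>b Z. negligible Z \<and> (\<forall>x\<in>{0..1} - Z. continuous (at x within {0..1}) (\<lambda>x. inner (f x) b))"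
  have "\<forall>b. \<exists>Z. ?P b Z"
  proof
    fix b
    have "(\<lambda>x. inner (f x) b) riemann_integrable_on {0..1}"
      by (rule riemann_integrable_on_comp[OF f bounded_linear_inner_left])
    then show "\<exists>Z. ?P b Z" by (rule riemann_integrable_negligible_discontinuities_real)
  qed
  from choice[OF this] obtain Z where Z: "\<forall>b. ?P b (Z b)" ..
  show ?thesis
  proof (intro exI conjI ballI)
    show "negligible (\<Union>(Z ` Basis))" using Z by (intro negligible_Union) auto
    fix x assume "x \<in> {0..1} - \<Union>(Z ` Basis)"
    then have "x \<in> {0..1} - Z b" if "b \<in> Basis" for b using that by auto
    then show "continuous (at x within {0..1}) f"
      using Z unfolding continuous_componentwise[of _ f] by simp
  qed
qed

section \<open>Fourier coefficients and convolution\<close>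

text \<open>Tannery's theorem: the majorant makes the partial sums converge uniformly in
  \<open>n\<close> by the Weierstrass test, so the sum and the limit along \<open>G\<close> can be
  exchanged.\<close>

lemma infsum_dominated_tendsto:
  fixes f :: "'n \<Rightarrow> 'k \<Rightarrow> 'b :: banach"
  assumes C: "C summable_on UNIV" and le: "\<And>n k. norm (f n k) \<le> C k"
    and lim: "\<And>k. ((\<lambda>n. f n k) \<longlongrightarrow> g k) G" and G: "G \<noteq> bot"
  shows "((\<lambda>n. \<Sum>\<^sub>\<infinity>k. f n k) \<longlongrightarrow> (\<Sum>\<^sub>\<infinity>k. g k)) G"
proof (rule swap_uniform_limit'[where S = UNIV and F = "finite_subsets_at_top UNIV"])
  have "norm (g k) \<le> C k" for k
    by (rule tendsto_upperbound[OF tendsto_norm[OF lim] _ G]) (simp add: le)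
  then have "g summable_on UNIV"
    by (intro abs_summable_summable[of g, OF summable_on_comparison_test[OF C]]) auto
  from has_sum_infsum[OF this]
  show "((\<lambda>X. \<Sum>k\<in>X. g k) \<longlongrightarrow> (\<Sum>\<^sub>\<infinity>k. g k)) (finite_subsets_at_top UNIV)"
    unfolding has_sum_def .
  show "uniform_limit UNIV (\<lambda>X n. \<Sum>k\<in>X. f n k) (\<lambda>n. \<Sum>\<^sub>\<infinity>k. f n k) (finite_subsets_at_top UNIV)"
    by (rule Weierstrass_m_test_general[OF le C])
qed (auto intro!: tendsto_sum lim)

lemma norm_has_sum_le_infsum:
  fixes f :: "'k \<Rightarrow> 'b :: banach"
  assumes "(f has_sum s) UNIV" "C summable_on UNIV" "\<And>k. norm (f k) \<le> C k"
  shows "norm s \<le> (\<Sum>\<^sub>\<infinity>k. C k)"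
  using norm_infsum_le[OF assms(1) has_sum_infsum[OF assms(2)]] assms(3) by blast

lemma measurable_ident_lebesgue_on [measurable]: "(\<lambda>t::real. t) \<in> borel_measurable (lebesgue_on S)"
  by (intro measurable_restrict_space1 measurable_completion) simp

lemma integrable_lebesgue_on_Icc_bounded:
  fixes f :: "real \<Rightarrow> 'b :: {banach, second_countable_topology}"
  assumes "f \<in> borel_measurable (lebesgue_on {u..v})" "\<And>t. t \<in> {u..v} \<Longrightarrow> norm (f t) \<le> B"
  shows "integrable (lebesgue_on {u..v}) f"
proof -
  interpret finite_measure "lebesgue_on {u..v}" by (rule finite_measure_lebesgue_on) simp
  show ?thesis using assms by (intro integrable_const_bound[of _ B]) (auto intro!: AE_I2)
qed

lemma norm_integral_lebesgue_on_Icc_le: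
  fixes f :: "real \<Rightarrow> 'b :: {banach, second_countable_topology}"
  assumes meas: "f \<in> borel_measurable (lebesgue_on {u..v})" and le: "\<And>t. t \<in> {u..v} \<Longrightarrow> norm (f t) \<le> B"
    and "u \<le> v"
  shows "norm (LINT t|lebesgue_on {u..v}. f t) \<le> (v - u) * B"
proof -
  have "norm (LINT t|lebesgue_on {u..v}. f t) \<le> (LINT t|lebesgue_on {u..v}. norm (f t))"
    by (rule integral_norm_bound)
  also have "\<dots> \<le> (LINT t|lebesgue_on {u..v}. B)"
    using meas le by (intro integral_mono integrable_lebesgue_on_Icc_bounded[of _ _ _ B] 
        integrable_lebesgue_on_Icc_bounded[of _ _ _ "\<bar>B\<bar>"] borel_measurable_norm) auto
  also have "\<dots> = (v - u) * B" using \<open>u \<le> v\<close> by (simp add: measure_restrict_space)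
  finally show ?thesis .
qed

text \<open>A function of \<open>t\<close> is regarded as a symbol constant in \<open>x\<close>; the
  point 0 is a placeholder.\<close>

abbreviation fcoeff :: "(real \<Rightarrow> complex) \<Rightarrow> int \<Rightarrow> complex" where
  "fcoeff F k \<equiv> fourier_coeff (\<lambda>_. F) k 0"

lemma norm_exp_i_of_int [simp]: "norm (exp (\<i> * of_int k * of_real t)) = 1"
  "norm (exp (- (\<i> * of_int k * of_real t))) = 1"
  by (simp_all add: norm_exp_eq_Re)

lemma norm_coeff_le:
  assumes [measurable]: "F \<in> borel_measurable (lebesgue_on {0..2*pi})"
    and B: "\<And>t. t \<in> {0..2*pi} \<Longrightarrow> norm (F t) \<le> B"
  shows "norm (fcoeff F k) \<le> B"
proof -
  have "norm (LINT t|lebesgue_on {0..2*pi}. F t * exp (- \<i> * of_int k * of_real t)) \<le> (2 * pi - 0) * B"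
    using B by (intro norm_integral_lebesgue_on_Icc_le) (auto simp: norm_mult)
  then show ?thesis by (simp add: fourier_coeff_def norm_divide divide_le_eq mult.commute)
qed

text \<open>The series of \<open>G\<close> converges uniformly, so it may be multiplied by the
  bounded \<open>F\<close> and integrated term by term. The roles are asymmetric because in the
  application \<open>F\<close> is the power product built so far and \<open>G\<close> the single
  next factor, whose coefficients have a summable majorant.\<close>

lemma coeff_mult_has_sum:
  assumes F [measurable]: "F \<in> borel_measurable (lebesgue_on {0..2*pi})"
    and G [measurable]: "G \<in> borel_measurable (lebesgue_on {0..2*pi})"
    and B: "\<And>t. t \<in> {0..2*pi} \<Longrightarrow> norm (F t) \<le> B"
    and C: "C summable_on UNIV" "\<And>k. norm (c k) \<le> C k"
    and series: "\<And>t. t \<in> {0..2*pi} \<Longrightarrow> ((\<lambda>k. c k * exp (\<i> * of_int k * of_real t)) has_sum G t) UNIV"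
  shows "((\<lambda>l. fcoeff F l * c (k - l)) has_sum fcoeff (\<lambda>t. F t * G t) k) UNIV"
proof -
  let ?I = "{0..2*pi}"
  let ?e = "\<lambda>k t. exp (\<i> * of_int k * of_real t) :: complex"
  have coeff_alt: "fcoeff F k = (LINT t|lebesgue_on ?I. F t * ?e (- k) t) / of_real (2 * pi)" for F k
    by (simp add: fourier_coeff_def)
  have e_add: "?e k t * ?e l t = ?e (k + l) t" for k l :: int and t
    by (simp add: exp_add[symmetric] algebra_simps)
  have B0: "0 \<le> B" using B[of 0] norm_ge_zero[of "F 0"] by (smt (verit) atLeastAtMost_iff pi_gt_zero)
  have G_le: "norm (G t) \<le> (\<Sum>\<^sub>\<infinity>k. C k)" if "t \<in> ?I" for t
    by (rule norm_has_sum_le_infsum[OF series[OF that] C(1)]) (simp add: norm_mult C(2))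
  have sum_G: "((\<lambda>X. \<Sum>m\<in>X. c m * fcoeff F (k - m)) \<longlongrightarrow> fcoeff (\<lambda>t. F t * G t) k) (finite_subsets_at_top UNIV)"
  proof (rule tendstoI)
    fix \<epsilon> :: real assume "\<epsilon> > 0"
    \<comment> \<open>The \<open>+ 1\<close> avoids division by 0 when \<open>B = 0\<close>; halving
      \<open>\<epsilon>\<close> makes the bound on \<open>B * \<delta>\<close> strict.\<close>
    define \<delta> where "\<delta> = \<epsilon> / 2 / (B + 1)"
    have \<delta>: "\<delta> > 0" using \<open>\<epsilon> > 0\<close> B0 by (simp add: \<delta>_def)
    have "B + 1 \<noteq> 0" using B0 by simp
    have "B * \<delta> \<le> (B + 1) * \<delta>" using \<delta> by (intro mult_right_mono) auto
    also have "(B + 1) * \<delta> = \<epsilon> / 2"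
      unfolding \<delta>_def using \<open>B + 1 \<noteq> 0\<close> by (metis nonzero_mult_div_cancel_left times_divide_eq_right)
    finally have B\<delta>: "B * \<delta> < \<epsilon>" using \<open>\<epsilon> > 0\<close> by simp
    have "uniform_limit ?I (\<lambda>X t. \<Sum>m\<in>X. c m * ?e m t) G (finite_subsets_at_top UNIV)"
      by (rule Weierstrass_m_test_general'[OF _ series C(1)]) (auto simp: norm_mult C(2))
    from uniform_limitD[OF this \<delta>]
    have "\<forall>\<^sub>F X in finite_subsets_at_top UNIV. \<forall>t\<in>?I. dist (\<Sum>m\<in>X. c m * ?e m t) (G t) < \<delta>" .
    moreover have "\<forall>\<^sub>F X in finite_subsets_at_top (UNIV :: int set). finite X"
      by (rule eventually_finite_subsets_at_top_weakI)
    ultimately show "\<forall>\<^sub>F X in finite_subsets_at_top UNIV.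
        dist (\<Sum>m\<in>X. c m * fcoeff F (k - m)) (fcoeff (\<lambda>t. F t * G t) k) < \<epsilon>"
    proof eventually_elim
      case (elim X)
      define P where "P t = (\<Sum>m\<in>X. c m * ?e m t)" for t
      have [measurable]: "P \<in> borel_measurable (lebesgue_on ?I)" unfolding P_def by measurable
      have P_le: "norm (P t) \<le> (\<Sum>m\<in>X. C m)" for t
        unfolding P_def by (intro sum_norm_le) (simp add: norm_mult C(2))
      have int_F: "integrable (lebesgue_on ?I) (\<lambda>t. F t * ?e j t)" for j :: int
        using B by (intro integrable_lebesgue_on_Icc_bounded[of _ _ _ B]) (auto simp: norm_mult)
      have int_FP: "integrable (lebesgue_on ?I) (\<lambda>t. F t * P t * ?e (- k) t)"
        using B P_le B0 by (intro integrable_lebesgue_on_Icc_bounded[of _ _ _ "B * (\<Sum>m\<in>X. C m)"])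
          (auto simp: norm_mult intro!: mult_mono)
      have int_FG: "integrable (lebesgue_on ?I) (\<lambda>t. F t * G t * ?e (- k) t)"
        using B G_le B0 by (intro integrable_lebesgue_on_Icc_bounded[of _ _ _ "B * (\<Sum>\<^sub>\<infinity>k. C k)"])
          (auto simp: norm_mult intro!: mult_mono)
      have "(LINT t|lebesgue_on ?I. F t * P t * ?e (- k) t) =
          (LINT t|lebesgue_on ?I. (\<Sum>m\<in>X. c m * (F t * ?e (- (k - m)) t)))"
      proof (rule Bochner_Integration.integral_cong[OF refl])
        fix t
        have "F t * P t * ?e (- k) t = (\<Sum>m\<in>X. c m * (F t * (?e m t * ?e (- k) t)))"
          unfolding P_def by (simp add: sum_distrib_left sum_distrib_right ac_simps)
        then show "F t * P t * ?e (- k) t = (\<Sum>m\<in>X. c m * (F t * ?e (- (k - m)) t))"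
          unfolding e_add by (simp add: algebra_simps)
      qed
      also have "\<dots> = (\<Sum>m\<in>X. c m * (LINT t|lebesgue_on ?I. F t * ?e (- (k - m)) t))"
        by (subst Bochner_Integration.integral_sum)
          (rule integrable_mult_right, rule int_F, simp only: integral_mult_right_zero)
      finally have coeff_P: "fcoeff (\<lambda>t. F t * P t) k = (\<Sum>m\<in>X. c m * fcoeff F (k - m))"
        unfolding coeff_alt by (simp only: sum_divide_distrib times_divide_eq_right)
      have "F t * (P t - G t) * ?e (- k) t = F t * P t * ?e (- k) t - F t * G t * ?e (- k) t" for t
        by (simp only: left_diff_distrib right_diff_distrib)
      then have "fcoeff (\<lambda>t. F t * P t) k - fcoeff (\<lambda>t. F t * G t) k = fcoeff (\<lambda>t. F t * (P t - G t)) k"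
        unfolding coeff_alt by (simp only: Bochner_Integration.integral_diff[OF int_FP int_FG] diff_divide_distrib)
      also have "norm \<dots> \<le> B * \<delta>"
        using B elim(1) B0 unfolding P_def[symmetric] dist_norm
        by (intro norm_coeff_le) (auto simp: norm_mult intro!: mult_mono intro: less_imp_le)
      finally show ?case using B\<delta> unfolding coeff_P dist_norm by simp
    qed
  qed
  \<comment> \<open>Substitution \<open>l = k - m\<close>: the sum so far is indexed by the
    coefficients \<open>c\<close>, the claim by those of \<open>F\<close>.\<close>
  have "bij_betw (\<lambda>l. k - l) UNIV (UNIV :: int set)" by (rule bij_betwI[of _ _ _ "\<lambda>l. k - l"]) auto
  from has_sum_reindex_bij_betw[OF this, of "\<lambda>m. c m * fcoeff F (k - m)"] sum_G
  show ?thesis unfolding has_sum_def[of "\<lambda>m. c m * fcoeff F (k - m)"] by (simp add: mult.commute)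
qed

text \<open>This is the empty word, where the induction starts. For nonzero \<open>k\<close> the
  exponential has an antiderivative that takes equal values at 0 and \<open>2*pi\<close>.\<close>

lemma coeff_one: "fcoeff (\<lambda>_. 1) k = (if k = 0 then 1 else 0)"
proof (cases "k = 0")
  case False
  define c where "c = - \<i> * of_int k"
  have c: "c \<noteq> 0" using False by (simp add: c_def)
  let ?e = "\<lambda>t. exp (c * of_real t) :: complex"
  let ?E = "\<lambda>t. ?e t / c"
  have "(?e has_integral ?E (2*pi) - ?E 0) {0..2*pi}"
  proof (rule fundamental_theorem_of_calculus)
    fix t
    have "((\<lambda>z. exp (c * z)) has_field_derivative ?e t * c) (at (of_real t))"
      by (rule DERIV_chain2[OF DERIV_exp]) (rule DERIV_cmult_Id)
    from DERIV_cdivide[OF this, of c]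
    have "((\<lambda>z. exp (c * z) / c) has_field_derivative ?e t) (at (of_real t))" using c by simp
    then show "(?E has_vector_derivative ?e t) (at t within {0..2*pi})"
      by (rule has_vector_derivative_at_within[OF has_vector_derivative_real_field])
  qed simp
  moreover have "?e (2*pi) = 1"
  proof -
    have "c * of_real (2*pi) = \<i> * (of_int (- k) * (of_real pi * 2))" unfolding c_def by simp
    then have "?e (2*pi) = exp (\<i> * (of_int (- k) * (of_real pi * 2)))" by (rule arg_cong)
    also have "\<dots> = 1" by (rule exp_2pi_1_int)
    finally show ?thesis .
  qed
  ultimately have 0: "(?e has_integral 0) {0..2*pi}" by simp
  have "integrable (lebesgue_on {0..2*pi}) ?e"
    by (intro integrable_lebesgue_on_Icc_bounded[of _ _ _ 1]) (measurable, simp add: c_def)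
  then have "(LINT t|lebesgue_on {0..2*pi}. ?e t) = integral {0..2*pi} ?e"
    by (intro lebesgue_integral_eq_integral) auto
  also have "\<dots> = 0" using 0 by (rule integral_unique)
  finally show ?thesis using False unfolding c_def by (simp add: fourier_coeff_def)
qed (simp add: fourier_coeff_def measure_restrict_space scaleR_conv_of_real)

section \<open>Rows of products of Kac-Murdock-Szego matrices\<close>

lemma floor_index_bounds:
  fixes x :: real
  assumes "0 \<le> x"
  defines "i \<equiv> \<lambda>n. nat \<lfloor>real (n + 1) * x\<rfloor>"
  shows "real (i n) \<le> real (n + 1) * x" "real (n + 1) * x < real (i n) + 1"
proof -
  have "0 \<le> real (n + 1) * x" using assms(1) by simp
  then have "real (i n) = of_int \<lfloor>real (n + 1) * x\<rfloor>" unfolding i_def by simp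
  then show "real (i n) \<le> real (n + 1) * x" "real (n + 1) * x < real (i n) + 1" by linarith+
qed

lemma floor_index_less:
  fixes x :: real
  assumes "0 \<le> x" "x < 1"
  shows "nat \<lfloor>real (n + 1) * x\<rfloor> < n + 1"
proof -
  have "real (n + 1) * x < real (n + 1)" using assms by simp
  then show ?thesis using floor_index_bounds(1)[OF assms(1), of n] by linarith
qed

lemma floor_index_div_tendsto:
  fixes x :: real
  assumes "0 \<le> x"
  shows "(\<lambda>n. real (nat \<lfloor>real (n + 1) * x\<rfloor>) / real (n + 1)) \<longlonglongrightarrow> x"
proof (rule tendsto_sandwich)
  have lim: "(\<lambda>n. x - 1 / real (n + 1)) \<longlonglongrightarrow> x - 0"
    by (intro tendsto_intros LIMSEQ_Suc[OF lim_1_over_n, unfolded Suc_eq_plus1])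
  then show "(\<lambda>n. x - 1 / real (n + 1)) \<longlonglongrightarrow> x" by simp
  show "\<forall>\<^sub>F n in sequentially. x - 1 / real (n + 1) \<le> real (nat \<lfloor>real (n + 1) * x\<rfloor>) / real (n + 1)"
  proof (intro always_eventually allI)
    fix n
    have "real (n + 1) * x - 1 \<le> real (nat \<lfloor>real (n + 1) * x\<rfloor>)"
      using floor_index_bounds(2)[OF assms, of n] by linarith
    then have "(real (n + 1) * x - 1) / real (n + 1) \<le> real (nat \<lfloor>real (n + 1) * x\<rfloor>) / real (n + 1)"
      by (rule divide_right_mono) simp
    then show "x - 1 / real (n + 1) \<le> real (nat \<lfloor>real (n + 1) * x\<rfloor>) / real (n + 1)"
      by (simp only: diff_divide_distrib) simp
  qed
  show "\<forall>\<^sub>F n in sequentially. real (nat \<lfloor>real (n + 1) * x\<rfloor>) / real (n + 1) \<le> x"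
    using floor_index_bounds(1)[OF assms]
    by (intro always_eventually allI) (simp add: divide_le_eq mult.commute del: of_nat_add)
qed simp

text \<open>Arbitrary coefficient functions are allowed so that the class is closed under adjoints
  and one step lemma serves for both kinds of factors.\<close>

definition kms_of_coeffs :: "(int \<Rightarrow> real \<Rightarrow> complex) \<Rightarrow> nat \<Rightarrow> complex mat" where
  "kms_of_coeffs c n = Matrix.mat (n + 1) (n + 1)
     (\<lambda>(i, j). c (int j - int i) (real (i + j) / real (2 * n + 2)))"

lemma kms_of_coeffs_carrier [simp]: "kms_of_coeffs c n \<in> carrier_mat (n + 1) (n + 1)"
  by (simp add: kms_of_coeffs_def)

lemma kms_of_coeffs_index:
  "i < n + 1 \<Longrightarrow> j < n + 1 \<Longrightarrow>
    kms_of_coeffs c n $$ (i, j) = c (int j - int i) (real (i + j) / real (2 * n + 2))"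
  by (simp add: kms_of_coeffs_def)

lemma kms_matrix_eq: "kms_matrix a = kms_of_coeffs (fourier_coeff a)"
  by (simp add: kms_matrix_def kms_of_coeffs_def fun_eq_iff)

text \<open>The sampling point is symmetric in row and column, so transposition only changes the
  sign of the offset \<open>k\<close>.\<close>

lemma adjoint_kms_of_coeffs:
  "mat_adjoint (kms_of_coeffs c n) = kms_of_coeffs (\<lambda>k x. cnj (c (- k) x)) n"
  by (rule eq_matI) (auto simp: kms_of_coeffs_def add.commute)

lemma sample_point_in_unit: "i < n + 1 \<Longrightarrow> j < n + 1 \<Longrightarrow> real (i + j) / real (2 * n + 2) \<in> {0..1}"
  by (auto simp: divide_le_eq)

text \<open>Row \<open>i\<close> recentred at the diagonal: offset \<open>l\<close> stands for
  column \<open>i + l\<close>, with 0 outside the matrix. Indexed by all integers, rows of matrices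
  of different sizes become comparable sequences.\<close>

definition row_entry :: "nat \<Rightarrow> nat \<Rightarrow> complex mat \<Rightarrow> int \<Rightarrow> complex" where
  "row_entry n i M l = (if 0 \<le> int i + l \<and> int i + l < int n + 1 then M $$ (i, nat (int i + l)) else 0)"

text \<open>Different \<open>l\<close> give different shifts. The two forms bound absolute column
  sums and absolute row sums of a matrix whose entries are majorized along diagonals.\<close>

lemma sum_shift_le_infsum:
  fixes C :: "int \<Rightarrow> real"
  assumes "C summable_on UNIV" "\<And>k. 0 \<le> C k"
  shows "(\<Sum>l<N. C (int j - int l)) \<le> (\<Sum>\<^sub>\<infinity>k. C k)" "(\<Sum>l<N. C (int l - int j)) \<le> (\<Sum>\<^sub>\<infinity>k. C k)"
proof -
  have "(\<Sum>l<N. C (int j - int l)) = (\<Sum>k\<in>(\<lambda>l. int j - int l) ` {..<N}. C k)"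
    by (subst sum.reindex) (auto simp: inj_on_def)
  also have "\<dots> \<le> (\<Sum>\<^sub>\<infinity>k. C k)" using assms by (intro finite_sum_le_infsum) auto
  finally show "(\<Sum>l<N. C (int j - int l)) \<le> (\<Sum>\<^sub>\<infinity>k. C k)" .
  have "(\<Sum>l<N. C (int l - int j)) = (\<Sum>k\<in>(\<lambda>l. int l - int j) ` {..<N}. C k)"
    by (subst sum.reindex) (auto simp: inj_on_def)
  also have "\<dots> \<le> (\<Sum>\<^sub>\<infinity>k. C k)" using assms by (intro finite_sum_le_infsum) auto
  finally show "(\<Sum>l<N. C (int l - int j)) \<le> (\<Sum>\<^sub>\<infinity>k. C k)" .
qed

text \<open>Entrywise bounds survive right multiplication, because the absolute column sums of the
  second factor are bounded independently of \<open>n\<close>.\<close>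

lemma norm_mult_kms_of_coeffs_le:
  assumes C: "C summable_on UNIV" and c: "\<And>k x. x \<in> {0..1} \<Longrightarrow> norm (c k x) \<le> C k"
    and W: "W \<in> carrier_mat (n + 1) (n + 1)" and B: "\<And>i j. i < n + 1 \<Longrightarrow> j < n + 1 \<Longrightarrow> norm (W $$ (i, j)) \<le> B"
    and ij: "i < n + 1" "j < n + 1"
  shows "norm ((W * kms_of_coeffs c n) $$ (i, j)) \<le> B * (\<Sum>\<^sub>\<infinity>k. C k)"
proof -
  have C0: "0 \<le> C k" for k using c[of 0 k] norm_ge_zero[of "c k 0"] by (smt (verit) atLeastAtMost_iff)
  have B0: "0 \<le> B" using B[OF ij] norm_ge_zero order_trans by blast
  have "(W * kms_of_coeffs c n) $$ (i, j) = (\<Sum>l<n + 1. W $$ (i, l) * kms_of_coeffs c n $$ (l, j))"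
    by (rule index_mult_mat_sum[OF W kms_of_coeffs_carrier ij])
  also have "norm \<dots> \<le> (\<Sum>l<n + 1. B * C (int j - int l))"
  proof (rule sum_norm_le)
    fix l assume "l \<in> {..<n + 1}"
    then have l: "l < n + 1" by simp
    then have "norm (kms_of_coeffs c n $$ (l, j)) \<le> C (int j - int l)"
      using ij c[OF sample_point_in_unit[OF l ij(2)]] by (simp add: kms_of_coeffs_def)
    then show "norm (W $$ (i, l) * kms_of_coeffs c n $$ (l, j)) \<le> B * C (int j - int l)"
      using B[OF ij(1) l] B0 unfolding norm_mult by (intro mult_mono) auto
  qed
  also have "\<dots> \<le> B * (\<Sum>\<^sub>\<infinity>k. C k)"
    unfolding sum_distrib_left[symmetric]
    by (intro mult_left_mono sum_shift_le_infsum(1)[OF C C0] B0)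
  finally show ?thesis .
qed

text \<open>Only the row is pinned at \<open>\<lfloor>(n + 1) x\<rfloor>\<close>; multiplication on the right
  by the matrix of \<open>c\<close> then acts, in the limit, as convolution with \<open>c\<close> frozen at the point \<open>x\<close>.\<close>

lemma row_entry_mult_tendsto:
  fixes x :: real
  assumes x: "0 < x" "x < 1"
    and C: "C summable_on UNIV" and c: "\<And>k x. x \<in> {0..1} \<Longrightarrow> norm (c k x) \<le> C k"
    and cont: "\<And>k. continuous (at x within {0..1}) (c k)"
    and W: "\<And>n. W n \<in> carrier_mat (n + 1) (n + 1)"
    and B: "\<And>n i j. i < n + 1 \<Longrightarrow> j < n + 1 \<Longrightarrow> norm (W n $$ (i, j)) \<le> B"
  defines "i \<equiv> \<lambda>n. nat \<lfloor>real (n + 1) * x\<rfloor>"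
  assumes lim: "\<And>l. (\<lambda>n. row_entry n (i n) (W n) l) \<longlonglongrightarrow> w l"
  shows "(\<lambda>n. row_entry n (i n) (W n * kms_of_coeffs c n) k) \<longlonglongrightarrow> (\<Sum>\<^sub>\<infinity>l. w l * c (k - l) x)"
proof -
  have C0: "0 \<le> C k" for k using c[of 0 k] norm_ge_zero[of "c k 0"] by (smt (verit) atLeastAtMost_iff)
  have B0: "0 \<le> B" using B[of 0 0 0] norm_ge_zero[of "W 0 $$ (0, 0)"] by linarith
  have i_less: "i n < n + 1" for n unfolding i_def using x by (intro floor_index_less) auto
  \<comment> \<open>\<open>R n l\<close> says that the column at offset \<open>l\<close> exists, and
    \<open>s n l\<close> is the sampling point of the entry with row offset \<open>l\<close> and
    column offset \<open>k\<close>. The summand \<open>f n l\<close> of the matrix product is set to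
    0 where it does not exist, so that the sum runs over all integers for every
    \<open>n\<close>.\<close>
  define R where "R n l \<longleftrightarrow> 0 \<le> int (i n) + l \<and> int (i n) + l < int n + 1" for n l
  define s where "s n l = (2 * real (i n) + real_of_int (l + k)) / real (2 * n + 2)" for n l
  define f where "f n l = (if R n k \<and> R n l then W n $$ (i n, nat (int (i n) + l)) * c (k - l) (s n l) else 0)" for n l
  have s_eq: "s n l = real (nat (int (i n) + l) + nat (int (i n) + k)) / real (2 * n + 2)"
    if "R n k" "R n l" for n l using that unfolding R_def s_def by simp
  have s_unit: "s n l \<in> {0..1}" if "R n k" "R n l" for n l
    unfolding s_eq[OF that] using that unfolding R_def by (intro sample_point_in_unit) auto
  have idiv: "(\<lambda>n. real (i n) / real (n + 1)) \<longlonglongrightarrow> x"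
    unfolding i_def using x by (intro floor_index_div_tendsto) simp
  have small: "(\<lambda>n. real_of_int l / real (n + 1)) \<longlonglongrightarrow> 0" for l
    using LIMSEQ_Suc[OF lim_const_over_n[of "real_of_int l"]] by simp
  \<comment> \<open>As \<open>x\<close> is interior, row \<open>i n\<close> moves away from both
    ends of the matrix, so each fixed offset eventually exists.\<close>
  have ev_R: "\<forall>\<^sub>F n in sequentially. R n l" for l
  proof -
    have "(\<lambda>n. real (i n) / real (n + 1) + real_of_int l / real (n + 1)) \<longlonglongrightarrow> x + 0"
      by (intro tendsto_add idiv small)
    then have t: "(\<lambda>n. real (i n) / real (n + 1) + real_of_int l / real (n + 1)) \<longlonglongrightarrow> x" by simp
    have "\<forall>\<^sub>F n in sequentially. 0 < real (i n) / real (n + 1) + real_of_int l / real (n + 1)"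
      using order_tendstoD(1)[OF t x(1)] .
    moreover have "\<forall>\<^sub>F n in sequentially. real (i n) / real (n + 1) + real_of_int l / real (n + 1) < 1"
      using order_tendstoD(2)[OF t x(2)] .
    ultimately show ?thesis
    proof eventually_elim
      case (elim n)
      then have "0 < real (i n) + real_of_int l" "real (i n) + real_of_int l < real (n + 1)"
        by (simp_all add: add_divide_distrib[symmetric] zero_less_divide_iff divide_less_eq del: of_nat_add)
      then show ?case unfolding R_def by linarith
    qed
  qed
  \<comment> \<open>Relative to \<open>i n / (n + 1)\<close> the offsets shift the sampling point by
    \<open>(l + k) / (2 * n + 2)\<close>, which tends to 0.\<close>
  have lim_s: "(\<lambda>n. s n l) \<longlonglongrightarrow> x" for l
  proof -
    have "(\<lambda>n. real (i n) / real (n + 1) + real_of_int (l + k) / real (n + 1) / 2) \<longlonglongrightarrow> x + 0 / 2"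
      by (intro tendsto_add idiv small tendsto_divide tendsto_const) simp
    moreover have "s n l = real (i n) / real (n + 1) + real_of_int (l + k) / real (n + 1) / 2" for n
      unfolding s_def by (simp add: divide_simps) (simp add: algebra_simps)
    ultimately show ?thesis by simp
  qed
  have "(\<lambda>n. \<Sum>\<^sub>\<infinity>l. f n l) \<longlonglongrightarrow> (\<Sum>\<^sub>\<infinity>l. w l * c (k - l) x)"
  proof (rule infsum_dominated_tendsto[where C = "\<lambda>l. B * C (k - l)"])
    have "bij_betw (\<lambda>l. k - l) UNIV (UNIV :: int set)" by (rule bij_betwI[of _ _ _ "\<lambda>l. k - l"]) auto
    from summable_on_reindex_bij_betw[OF this, of C] C
    have "(\<lambda>l. C (k - l)) summable_on UNIV" by simp
    then show "(\<lambda>l. B * C (k - l)) summable_on UNIV" by (rule summable_on_cmult_right)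
    show "norm (f n l) \<le> B * C (k - l)" for n l
    proof (cases "R n k \<and> R n l")
      case True
      then have "norm (W n $$ (i n, nat (int (i n) + l))) \<le> B"
        using i_less[of n] unfolding R_def by (intro B) auto
      moreover have "norm (c (k - l) (s n l)) \<le> C (k - l)" using True by (intro c s_unit) auto
      ultimately show ?thesis using True B0 unfolding f_def by (simp add: norm_mult mult_mono)
    next
      case False
      then have "f n l = 0" by (auto simp: f_def)
      then show ?thesis using B0 C0 by simp
    qed
    show "(\<lambda>n. f n l) \<longlonglongrightarrow> w l * c (k - l) x" for l
    proof -
      have ev: "\<forall>\<^sub>F n in sequentially. R n k \<and> R n l" using ev_R by (intro eventually_conj)
      have "(\<lambda>n. c (k - l) (s n l)) \<longlonglongrightarrow> c (k - l) x"
      proof (rule continuous_within_tendsto_compose[OF cont _ lim_s])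
        show "\<forall>\<^sub>F n in sequentially. s n l \<in> {0..1}" using ev by eventually_elim (blast intro: s_unit)
      qed
      with lim have "(\<lambda>n. row_entry n (i n) (W n) l * c (k - l) (s n l)) \<longlonglongrightarrow> w l * c (k - l) x"
        by (rule tendsto_mult)
      moreover have "\<forall>\<^sub>F n in sequentially. row_entry n (i n) (W n) l * c (k - l) (s n l) = f n l"
        using ev by eventually_elim (simp add: f_def row_entry_def R_def)
      ultimately show ?thesis by (rule Lim_transform_eventually)
    qed
  qed simp
  moreover have "\<forall>\<^sub>F n in sequentially. (\<Sum>\<^sub>\<infinity>l. f n l) = row_entry n (i n) (W n * kms_of_coeffs c n) k"
    using ev_R[of k]
  proof eventually_elim
    case (elim n)
    have j: "nat (int (i n) + k) < n + 1" using elim unfolding R_def by auto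
    define L where "L = {l. R n l}"
    have L_eq: "L = {- int (i n)..int n - int (i n)}" unfolding L_def R_def by auto
    have "(\<Sum>\<^sub>\<infinity>l. f n l) = (\<Sum>l\<in>L. f n l)"
      by (rule infsumI, rule has_sum_finite_neutralI[of L]) (simp add: L_eq, auto simp: L_def f_def)
    also have "\<dots> = (\<Sum>j<n + 1. W n $$ (i n, j) * kms_of_coeffs c n $$ (j, nat (int (i n) + k)))"
    proof (rule sum.reindex_bij_witness[of _ "\<lambda>j. int j - int (i n)" "\<lambda>l. nat (int (i n) + l)"])
      fix l assume "l \<in> L"
      then have l: "R n l" by (simp add: L_def)
      then have l_less: "nat (int (i n) + l) < n + 1" unfolding R_def by auto
      have diff: "int (nat (int (i n) + k)) - int (nat (int (i n) + l)) = k - l"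
        using l elim unfolding R_def by auto
      show "W n $$ (i n, nat (int (i n) + l)) * kms_of_coeffs c n $$ (nat (int (i n) + l), nat (int (i n) + k)) = f n l"
        unfolding kms_of_coeffs_index[OF l_less j] diff s_eq[OF elim l, symmetric] f_def using l elim by simp
    qed (auto simp: L_def R_def)
    also have "\<dots> = (W n * kms_of_coeffs c n) $$ (i n, nat (int (i n) + k))"
      by (rule index_mult_mat_sum[OF W kms_of_coeffs_carrier i_less j, symmetric])
    also have "\<dots> = row_entry n (i n) (W n * kms_of_coeffs c n) k"
      using elim by (simp add: row_entry_def R_def)
    finally show ?case .
  qed
  ultimately show ?thesis by (rule Lim_transform_eventually)
qed

section \<open>Riemann sums and Lebesgue integrals\<close>

lemma AE_lebesgue_on_negligible:
  assumes "S \<in> sets lebesgue" "negligible Z" "\<And>x. x \<in> S - Z \<Longrightarrow> P x"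
  shows "AE x in lebesgue_on S. P x"
proof -
  have "AE x in lebesgue. x \<notin> Z"
    using assms(2) by (intro AE_not_in) (simp add: negligible_iff_null_sets)
  then have "AE x in lebesgue. x \<in> S \<longrightarrow> P x" by eventually_elim (use assms(3) in blast)
  then show ?thesis using assms(1) by (subst AE_restrict_space_iff) auto
qed

text \<open>Cutting off to \<open>S - Z\<close> gives a limit at every point; completeness of
  Lebesgue measure then allows changing the values on \<open>Z\<close>.\<close>

lemma borel_measurable_lebesgue_on_limit:
  fixes f :: "nat \<Rightarrow> real \<Rightarrow> complex"
  assumes S: "S \<in> sets lebesgue" and Z: "negligible Z"
    and f: "\<And>n. f n \<in> borel_measurable (lebesgue_on S)"
    and lim: "\<And>x. x \<in> S - Z \<Longrightarrow> (\<lambda>n. f n x) \<longlonglongrightarrow> h x"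
  shows "h \<in> borel_measurable (lebesgue_on S)"
proof -
  have Zs: "Z \<in> sets lebesgue" using Z by (rule negligible_imp_sets)
  define g where "g n x = indicator (S - Z) x *\<^sub>R (indicator S x *\<^sub>R f n x)" for n x
  have fS: "(\<lambda>x. indicator S x *\<^sub>R f n x) \<in> borel_measurable lebesgue" for n
    using f[of n] S by (subst (asm) borel_measurable_restrict_space_iff) auto
  have "g n \<in> borel_measurable lebesgue" for n
    unfolding g_def using S Zs by (intro borel_measurable_scaleR[OF borel_measurable_indicator fS]) auto
  moreover have "(\<lambda>n. g n x) \<longlonglongrightarrow> indicator (S - Z) x *\<^sub>R h x" for x
    using lim[of x] by (cases "x \<in> S - Z") (auto simp: g_def indicator_def)
  ultimately have "(\<lambda>x. indicator (S - Z) x *\<^sub>R h x) \<in> borel_measurable lebesgue"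
    by (rule borel_measurable_LIMSEQ_metric)
  moreover have "AE x in lebesgue. x \<notin> Z"
    using Z by (intro AE_not_in) (simp add: negligible_iff_null_sets)
  then have "AE x in lebesgue. indicator (S - Z) x *\<^sub>R h x = indicator S x *\<^sub>R h x"
    by eventually_elim (auto simp: indicator_def)
  ultimately have "(\<lambda>x. indicator S x *\<^sub>R h x) \<in> borel_measurable lebesgue"
    by (rule borel_measurable_AE)
  then show ?thesis using S by (subst borel_measurable_restrict_space_iff) auto
qed

text \<open>The mean of \<open>v n\<close> is the integral of the step function with value
  \<open>v n i\<close> on the \<open>i\<close>-th of \<open>n + 1\<close> equal cells, and dominated
  convergence applies. Measurability of \<open>h\<close> is a product of the limit, so the first
  conclusion also serves as an integrability criterion.\<close>

lemma step_sequence_integral: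
  fixes v :: "nat \<Rightarrow> nat \<Rightarrow> complex"
  assumes bound: "\<And>n i. i < n + 1 \<Longrightarrow> norm (v n i) \<le> B" and Z: "negligible Z"
    and lim: "\<And>x. 0 < x \<Longrightarrow> x < 1 \<Longrightarrow> x \<notin> Z \<Longrightarrow> (\<lambda>n. v n (nat \<lfloor>real (n + 1) * x\<rfloor>)) \<longlonglongrightarrow> h x"
  shows "integrable (lebesgue_on {0..1}) h"
    and "(\<lambda>n. (\<Sum>i<n + 1. v n i) / of_nat (n + 1)) \<longlonglongrightarrow> (LINT x|lebesgue_on {0..1}. h x)"
proof -
  let ?L = "lebesgue_on {0..1::real}"
  \<comment> \<open>Half-open cells make the cell of a point unique; the point 1 then lies in none,
    and \<open>D n 1\<close> is 0.\<close>
  define J where "J n i = {real i / real (n + 1)..<(real i + 1) / real (n + 1)}" for n i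
  define D where "D n x = (\<Sum>i<n + 1. indicator (J n i) x *\<^sub>R v n i)" for n x
  have B0: "0 \<le> B" using bound[of 0 0] norm_ge_zero[of "v 0 0"] by linarith
  have mem_J: "x \<in> J n i \<longleftrightarrow> i = nat \<lfloor>real (n + 1) * x\<rfloor>" if "0 \<le> x" for n i x
  proof -
    have "x \<in> J n i \<longleftrightarrow> real i \<le> real (n + 1) * x \<and> real (n + 1) * x < real i + 1"
      unfolding J_def by (simp add: divide_le_eq less_divide_eq mult.commute del: of_nat_add)
    also have "\<dots> \<longleftrightarrow> \<lfloor>real (n + 1) * x\<rfloor> = int i" by (simp only: floor_eq_iff of_int_of_nat_eq)
    also have "\<dots> \<longleftrightarrow> i = nat \<lfloor>real (n + 1) * x\<rfloor>" using that by auto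
    finally show ?thesis .
  qed
  have D_eq: "D n x = v n (nat \<lfloor>real (n + 1) * x\<rfloor>)" and i_less: "nat \<lfloor>real (n + 1) * x\<rfloor> < n + 1"
    if x: "0 \<le> x" "x < 1" for n x
  proof -
    have "real (n + 1) * x < real (n + 1)" using x by simp
    then show less: "nat \<lfloor>real (n + 1) * x\<rfloor> < n + 1"
      using x by (simp add: nat_less_iff floor_less_iff del: of_nat_add)
    have "D n x = (\<Sum>i<n + 1. if i = nat \<lfloor>real (n + 1) * x\<rfloor> then v n i else 0)"
      unfolding D_def using mem_J[OF x(1)] by (intro sum.cong) (auto simp: indicator_def)
    then show "D n x = v n (nat \<lfloor>real (n + 1) * x\<rfloor>)" using less by (simp only: sum.delta finite_lessThan lessThan_iff if_True)
  qed
  have D_1: "D n 1 = 0" for n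
    unfolding D_def using mem_J[of 1 n] by (intro sum.neutral) (auto simp: indicator_def)
  have D_le: "norm (D n x) \<le> B" if "x \<in> {0..1}" for n x
    using that D_eq[of x n] i_less[of x n] bound B0 by (cases "x = 1") (auto simp: D_1)
  have D_meas [measurable]: "D n \<in> borel_measurable ?L" for n
    unfolding D_def J_def by measurable
  have Z': "negligible (Z \<union> {0, 1})" by (rule negligible_Un[OF Z]) (rule negligible_finite, simp)
  have lim': "(\<lambda>n. D n x) \<longlonglongrightarrow> h x" if "x \<in> {0..1} - (Z \<union> {0, 1})" for x
    using that lim[of x] by (auto simp: D_eq)
  have h_meas: "h \<in> borel_measurable ?L"
    by (rule borel_measurable_lebesgue_on_limit[OF _ Z' D_meas lim']) auto
  have bnd: "integrable ?L (\<lambda>_. B)" by (intro integrable_lebesgue_on_Icc_bounded[of _ _ _ B]) (auto simp: B0)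
  have AE_lim: "AE x in ?L. (\<lambda>n. D n x) \<longlonglongrightarrow> h x"
    by (rule AE_lebesgue_on_negligible[OF _ Z' lim']) auto
  have AE_le: "AE x in ?L. norm (D n x) \<le> B" for n
    by (intro AE_I2 D_le) (simp add: space_restrict_space)
  show "integrable ?L h"
    by (rule integrable_dominated_convergence[OF h_meas D_meas bnd AE_lim AE_le])
  have "(LINT x|?L. D n x) = (\<Sum>i<n + 1. v n i) / of_nat (n + 1)" for n
  proof -
    have meas_J: "measure ?L (J n i) = 1 / real (n + 1)" and sets_J: "J n i \<in> sets ?L" if "i < n + 1" for i
    proof -
      have le: "(real i + 1) / real (n + 1) \<le> 1" using that by (simp add: divide_le_eq)
      have ge: "0 \<le> real i / real (n + 1)" by simp
      have sub: "J n i \<subseteq> {0..1}"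
      proof
        fix x assume "x \<in> J n i"
        then have "real i / real (n + 1) \<le> x" "x < (real i + 1) / real (n + 1)" by (auto simp only: J_def atLeastLessThan_iff)
        then show "x \<in> {0..1}" using le ge unfolding atLeastAtMost_iff by linarith
      qed
      then show "J n i \<in> sets ?L" by (auto simp: sets_restrict_space J_def)
      have "measure ?L (J n i) = measure lebesgue (J n i)" using sub by (intro measure_restrict_space) auto
      then show "measure ?L (J n i) = 1 / real (n + 1)"
        unfolding J_def by (simp add: divide_right_mono diff_divide_distrib[symmetric] del: of_nat_add)
    qed
    have "(LINT x|?L. D n x) = (\<Sum>i<n + 1. LINT x|?L. indicator (J n i) x *\<^sub>R v n i)"
      unfolding D_def
    proof (rule Bochner_Integration.integral_sum)
      fix i assume "i \<in> {..<n + 1}"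
      then show "integrable ?L (\<lambda>x. indicator (J n i) x *\<^sub>R v n i)"
        using sets_J[of i] by (intro integrable_lebesgue_on_Icc_bounded[of _ _ _ "norm (v n i)"]) (auto simp: indicator_def)
    qed
    also have "\<dots> = (\<Sum>i<n + 1. v n i / of_nat (n + 1))"
    proof (intro sum.cong refl)
      fix i assume "i \<in> {..<n + 1}"
      then have i: "i < n + 1" by simp
      have "integrable ?L (indicat_real (J n i))"
        using sets_J[OF i] by (intro integrable_lebesgue_on_Icc_bounded[of _ _ _ 1]) (auto simp: indicator_def)
      then have "(LINT x|?L. indicator (J n i) x *\<^sub>R v n i) = (LINT x|?L. indicator (J n i) x) *\<^sub>R v n i"
        by (intro integral_scaleR_left)
      also have "(LINT x|?L. indicator (J n i) x) = 1 / real (n + 1)"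
        using meas_J[OF i] sets.sets_into_space[OF sets_J[OF i]] by (simp add: Int_absorb2 space_restrict_space)
      finally show "(LINT x|?L. indicator (J n i) x *\<^sub>R v n i) = v n i / of_nat (n + 1)"
        by (simp add: scaleR_conv_of_real)
    qed
    finally show ?thesis unfolding sum_divide_distrib .
  qed
  moreover have "(\<lambda>n. LINT x|?L. D n x) \<longlonglongrightarrow> (LINT x|?L. h x)"
    by (rule integral_dominated_convergence[OF h_meas D_meas bnd AE_lim AE_le])
  ultimately show "(\<lambda>n. (\<Sum>i<n + 1. v n i) / of_nat (n + 1)) \<longlonglongrightarrow> (LINT x|?L. h x)" by simp
qed

section \<open>The symbol and its averages\<close>

text \<open>The extended real norm is replaced by real majorants \<open>A k\<close>; the final
  theorem takes for them the suprema of the coefficients.\<close>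

locale kms_symbol =
  fixes a :: "real \<Rightarrow> real \<Rightarrow> complex" and A :: "int \<Rightarrow> real"
  assumes series: "\<And>x t. x \<in> {0..1} \<Longrightarrow> t \<in> {0..2*pi} \<Longrightarrow>
      ((\<lambda>k. fourier_coeff a k x * exp (\<i> * of_int k * of_real t)) has_sum a x t) UNIV"
    and riemann: "\<And>t. t \<in> {0..2*pi} \<Longrightarrow> (\<lambda>x. a x t) riemann_integrable_on {0..1}"
    and measurable_symbol: "\<And>x. x \<in> {0..1} \<Longrightarrow> a x \<in> borel_measurable (lebesgue_on {0..2*pi})"
    and coeff_le: "\<And>k x. x \<in> {0..1} \<Longrightarrow> norm (fourier_coeff a k x) \<le> A k"
    and A_summable: "A summable_on UNIV"
begin

definition M :: real where "M = (\<Sum>\<^sub>\<infinity>k. A k)"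

lemma A_nonneg: "0 \<le> A k"
  using coeff_le[of 0 k] norm_ge_zero[of "fourier_coeff a k 0"] by (smt (verit) atLeastAtMost_iff)

lemma M_nonneg: "0 \<le> M"
  unfolding M_def by (rule infsum_nonneg) (rule A_nonneg)

lemma norm_symbol_le: "x \<in> {0..1} \<Longrightarrow> t \<in> {0..2*pi} \<Longrightarrow> norm (a x t) \<le> M"
  unfolding M_def
  by (rule norm_has_sum_le_infsum[OF series A_summable]) (auto simp: norm_mult coeff_le)

text \<open>The modulus \<open>\<omega>\<close> is built from the majorants alone, hence does not
  depend on \<open>x\<close>. It tends to 0 at \<open>t\<close> by dominated convergence, its terms
  being at most \<open>2 * A k\<close>.\<close>

lemma symbol_equicontinuous:
  assumes t: "t \<in> {0..2*pi}" and e: "e > 0"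
  shows "\<exists>d>0. \<forall>x\<in>{0..1}. \<forall>s\<in>{0..2*pi}. \<bar>s - t\<bar> < d \<longrightarrow> norm (a x s - a x t) < e"
proof -
  let ?e = "\<lambda>k t. exp (\<i> * of_int k * of_real t) :: complex"
  define \<omega> where "\<omega> s = (\<Sum>\<^sub>\<infinity>k. A k * norm (?e k s - ?e k t))" for s
  have term_le: "A k * norm (?e k s - ?e k t) \<le> 2 * A k" for k s
    using norm_triangle_ineq4[of "?e k s" "?e k t"] A_nonneg[of k]
      mult_left_mono[of "norm (?e k s - ?e k t)" 2 "A k"] by (simp add: mult.commute)
  have sum2: "(\<lambda>k. 2 * A k) summable_on UNIV" by (rule summable_on_cmult_right[OF A_summable])
  have "(\<omega> \<longlongrightarrow> (\<Sum>\<^sub>\<infinity>k::int. A k * norm (?e k t - ?e k t))) (at t)"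
    unfolding \<omega>_def
  proof (rule infsum_dominated_tendsto[OF sum2])
    show "((\<lambda>s. A k * norm (?e k s - ?e k t)) \<longlongrightarrow> A k * norm (?e k t - ?e k t)) (at t)" for k
      by (intro tendsto_intros)
  qed (use term_le A_nonneg in auto)
  then have "(\<omega> \<longlongrightarrow> 0) (at t)" by simp
  then have "\<forall>\<^sub>F s in at t. dist (\<omega> s) 0 < e" using e by (rule tendstoD)
  then have "\<exists>d>0. \<forall>s. s \<noteq> t \<and> dist s t < d \<longrightarrow> dist (\<omega> s) 0 < e"
    unfolding eventually_at by simp
  then obtain d where d: "d > 0" and \<omega>_less: "\<forall>s. s \<noteq> t \<and> dist s t < d \<longrightarrow> dist (\<omega> s) 0 < e"
    by (elim exE conjE)
  have \<omega>_t: "\<omega> t = 0" by (simp add: \<omega>_def)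
  show ?thesis
  proof (intro exI[of _ d] conjI ballI impI)
    fix x s :: real assume x: "x \<in> {0..1}" and s: "s \<in> {0..2*pi}" "\<bar>s - t\<bar> < d"
    have "((\<lambda>k. fourier_coeff a k x * ?e k s - fourier_coeff a k x * ?e k t) has_sum (a x s - a x t)) UNIV"
      using has_sum_add[OF series[OF x s(1)] has_sum_cmult_right[OF series[OF x t], of "- 1"]] by simp
    then have "norm (a x s - a x t) \<le> \<omega> s"
      unfolding \<omega>_def
    proof (rule norm_has_sum_le_infsum)
      show "(\<lambda>k. A k * norm (?e k s - ?e k t)) summable_on UNIV"
        by (rule summable_on_comparison_test[OF sum2]) (use term_le A_nonneg in auto)
      show "norm (fourier_coeff a k x * ?e k s - fourier_coeff a k x * ?e k t) \<le> A k * norm (?e k s - ?e k t)" for k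
        using coeff_le[OF x, of k]
        by (simp only: right_diff_distrib[symmetric] norm_mult) (rule mult_right_mono, auto)
    qed
    also have "\<omega> s < e"
      using spec[OF \<omega>_less, of s] s \<omega>_t e by (cases "s = t") (auto simp: dist_real_def)
    finally show "norm (a x s - a x t) < e" .
  qed (rule d)
qed

text \<open>Continuity in \<open>x\<close> can be secured for countably many \<open>t\<close> off a null set; equicontinuity
  in \<open>t\<close>, which is uniform in \<open>x\<close>, extends it to all \<open>t\<close>.\<close>

lemma symbol_continuous_ae:
  "\<exists>Z. negligible Z \<and> (\<forall>x\<in>{0..1} - Z. \<forall>t\<in>{0..2*pi}. continuous (at x within {0..1}) (\<lambda>x. a x t))"
proof -
  let ?P = "\<lambda>t Z. t \<in> {0..2*pi} \<longrightarrow> negligible Z \<and> (\<forall>x\<in>{0..1} - Z. continuous (at x within {0..1}) (\<lambda>x. a x t))"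
  have "\<forall>t. \<exists>Z. ?P t Z"
    using riemann_integrable_negligible_discontinuities[OF riemann] by simp
  from choice[OF this] obtain Z where Z: "\<forall>t. ?P t (Z t)" ..
  define Q where "Q = \<rat> \<inter> {0..2*pi}"
  show ?thesis
  proof (intro exI[of _ "\<Union>(Z ` Q)"] conjI ballI)
    have "countable Q" unfolding Q_def by (intro countable_Int1 countable_rat)
    then show "negligible (\<Union>(Z ` Q))"
      using Z by (intro negligible_countable_Union) (auto simp: Q_def)
    fix x t assume x: "x \<in> {0..1} - \<Union>(Z ` Q)" and t: "t \<in> {0..2*pi}"
    show "continuous (at x within {0..1}) (\<lambda>x. a x t)"
      unfolding continuous_within_eps_delta
    proof (intro allI impI)
      fix e :: real assume "e > 0"
      then have e3: "e / 3 > 0" by simp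
      from symbol_equicontinuous[OF t e3] obtain d where d: "d > 0"
        and eq: "\<forall>x\<in>{0..1}. \<forall>s\<in>{0..2*pi}. \<bar>s - t\<bar> < d \<longrightarrow> norm (a x s - a x t) < e / 3"
        by (elim exE conjE)
      \<comment> \<open>Clipping keeps the rational \<open>s\<close> inside the domain and leaves a
        nonempty interval even when \<open>t\<close> is an endpoint.\<close>
      have "max 0 (t - d) < min (2*pi) (t + d)" using t d pi_gt_zero by auto
      then obtain s where s: "s \<in> \<rat>" "max 0 (t - d) < s" "s < min (2*pi) (t + d)"
        using Rats_dense_in_real by blast
      then have sQ: "s \<in> Q" "s \<in> {0..2*pi}" "\<bar>s - t\<bar> < d" by (auto simp: Q_def)
      then have "continuous (at x within {0..1}) (\<lambda>x. a x s)" using Z x by auto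
      from this[unfolded continuous_within_eps_delta, THEN spec, THEN mp, OF e3] obtain r
        where r: "r > 0" and close: "\<forall>x'\<in>{0..1}. dist x' x < r \<longrightarrow> dist (a x' s) (a x s) < e / 3"
        by (elim exE conjE)
      show "\<exists>r>0. \<forall>x'\<in>{0..1}. dist x' x < r \<longrightarrow> dist (a x' t) (a x t) < e"
      proof (intro exI[of _ r] conjI ballI impI)
        fix x' assume x': "x' \<in> {0..1}" "dist x' x < r"
        have "dist (a x' t) (a x' s) < e / 3" using eq x'(1) sQ(2,3) by (simp add: dist_norm norm_minus_commute)
        moreover have "dist (a x' s) (a x s) < e / 3" using close x' by simp
        moreover have "dist (a x s) (a x t) < e / 3" using eq sQ(2,3) x by (simp add: dist_norm)
        ultimately show "dist (a x' t) (a x t) < e"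
          using dist_triangle[of "a x' t" "a x t" "a x' s"] dist_triangle[of "a x' s" "a x t" "a x s"] by linarith
      qed (rule r)
    qed
  qed
qed

lemma continuous_bounded_on_disk:
  fixes \<Phi> :: "complex \<Rightarrow> complex"
  assumes "continuous_on UNIV \<Phi>"
  shows "\<exists>K. \<forall>z. norm z \<le> M \<longrightarrow> norm (\<Phi> z) \<le> K"
proof -
  have "compact (\<Phi> ` cball 0 M)"
    using assms by (intro compact_continuous_image continuous_on_subset[OF assms]) auto
  then have "bounded (\<Phi> ` cball 0 M)" by (rule compact_imp_bounded)
  then obtain K where "\<forall>z\<in>cball 0 M. norm (\<Phi> z) \<le> K" unfolding bounded_iff by auto
  then show ?thesis by (intro exI[of _ K]) simp
qed

lemma measurable_comp_symbol:
  assumes "continuous_on UNIV \<Phi>" "x \<in> {0..1}"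
  shows "(\<lambda>t. \<Phi> (a x t) :: complex) \<in> borel_measurable (lebesgue_on {0..2*pi})"
  using measurable_compose[OF measurable_symbol[OF assms(2)] borel_measurable_continuous_onI[OF assms(1)]] .

text \<open>With \<open>e\<close> an exponential this yields continuity of the Fourier coefficients,
  with \<open>e = 1\<close> that of the inner integral. Convergence is dominated because the symbol
  stays in the disk of radius \<open>M\<close>, where \<open>\<Phi>\<close> is bounded.\<close>

lemma integral_continuous_in_point:
  assumes cont: "\<And>t. t \<in> {0..2*pi} \<Longrightarrow> continuous (at x within {0..1}) (\<lambda>x. a x t)"
    and \<Phi>: "continuous_on UNIV \<Phi>" and x: "x \<in> {0..1}"
    and e [measurable]: "e \<in> borel_measurable (lebesgue_on {0..2*pi})" and e1: "\<And>t. norm (e t :: complex) \<le> 1"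
  shows "continuous (at x within {0..1}) (\<lambda>x. LINT t|lebesgue_on {0..2*pi}. \<Phi> (a x t) * e t)"
  unfolding continuous_within_sequentially
proof (intro allI impI)
  fix y :: "nat \<Rightarrow> real" assume y: "(\<forall>n. y n \<in> {0..1}) \<and> y \<longlonglongrightarrow> x"
  obtain K where "\<forall>z. norm z \<le> M \<longrightarrow> norm (\<Phi> z) \<le> K" using continuous_bounded_on_disk[OF \<Phi>] ..
  then have K: "norm (\<Phi> z) \<le> K" if "norm z \<le> M" for z using that by blast
  have K0: "0 \<le> K" using K[of 0] M_nonneg norm_ge_zero[of "\<Phi> 0"] unfolding norm_zero by linarith
  show "((\<lambda>x. LINT t|lebesgue_on {0..2*pi}. \<Phi> (a x t) * e t) \<circ> y) \<longlonglongrightarrow>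
      (LINT t|lebesgue_on {0..2*pi}. \<Phi> (a x t) * e t)"
    unfolding o_def
  proof (rule integral_dominated_convergence)
    show "(\<lambda>t. \<Phi> (a x t) * e t) \<in> borel_measurable (lebesgue_on {0..2*pi})"
      by (rule borel_measurable_times[OF measurable_comp_symbol[OF \<Phi> x] e])
    show "(\<lambda>t. \<Phi> (a (y n) t) * e t) \<in> borel_measurable (lebesgue_on {0..2*pi})" for n
      using y by (intro borel_measurable_times[OF measurable_comp_symbol[OF \<Phi>] e]) auto
    show "integrable (lebesgue_on {0..2*pi}) (\<lambda>_. K)"
      by (intro integrable_lebesgue_on_Icc_bounded[of _ _ _ K]) (auto simp: K0)
    show "AE t in lebesgue_on {0..2*pi}. (\<lambda>n. \<Phi> (a (y n) t) * e t) \<longlonglongrightarrow> \<Phi> (a x t) * e t"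
    proof (rule AE_I2)
      fix t assume "t \<in> space (lebesgue_on {0..2*pi})"
      then have "t \<in> {0..2*pi}" by (simp add: space_restrict_space)
      from cont[OF this] y have "(\<lambda>n. a (y n) t) \<longlonglongrightarrow> a x t"
        unfolding continuous_within_sequentially o_def by blast
      moreover have "isCont \<Phi> (a x t)" using \<Phi> by (simp add: continuous_on_eq_continuous_at)
      ultimately have "(\<lambda>n. \<Phi> (a (y n) t)) \<longlonglongrightarrow> \<Phi> (a x t)" by (rule isCont_tendsto_compose[rotated])
      then show "(\<lambda>n. \<Phi> (a (y n) t) * e t) \<longlonglongrightarrow> \<Phi> (a x t) * e t" by (intro tendsto_intros)
    qed
    show "AE t in lebesgue_on {0..2*pi}. norm (\<Phi> (a (y n) t) * e t) \<le> K" for n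
    proof (rule AE_I2)
      fix t assume "t \<in> space (lebesgue_on {0..2*pi})"
      then have "norm (\<Phi> (a (y n) t)) \<le> K" using y by (intro K norm_symbol_le) (auto simp: space_restrict_space)
      then show "norm (\<Phi> (a (y n) t) * e t) \<le> K"
        using mult_mono[OF _ e1[of t] K0] by (simp add: norm_mult)
    qed
  qed
qed

end

section \<open>Approximation by polynomials in z and its conjugate\<close>

text \<open>The complex linear span of the monomials. Products are not a constructor, since the
  limit statement passes through linear combinations only; closure under them is proved next, for
  Stone-Weierstrass.\<close>

inductive conj_polynomial :: "(complex \<Rightarrow> complex) \<Rightarrow> bool" where
  monomial: "conj_polynomial (\<lambda>z. z ^ p * cnj z ^ q)"
| add: "conj_polynomial f \<Longrightarrow> conj_polynomial g \<Longrightarrow> conj_polynomial (\<lambda>z. f z + g z)"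
| scale: "conj_polynomial f \<Longrightarrow> conj_polynomial (\<lambda>z. c * f z)"

lemma conj_polynomial_const: "conj_polynomial (\<lambda>_. c)"
  using conj_polynomial.scale[OF conj_polynomial.monomial[of 0 0], of c] by simp

lemma conj_polynomial_mult:
  assumes "conj_polynomial f" "conj_polynomial g"
  shows "conj_polynomial (\<lambda>z. f z * g z)"
  using assms(1)
proof induction
  case (monomial p q)
  from assms(2) show ?case
  proof induction
    case (monomial p' q')
    have "(\<lambda>z. z ^ p * cnj z ^ q * (z ^ p' * cnj z ^ q')) = (\<lambda>z. z ^ (p + p') * cnj z ^ (q + q'))"
      by (simp add: power_add fun_eq_iff ac_simps)
    then show ?case by (simp add: conj_polynomial.monomial)
  next
    case (add f g)
    then show ?case by (simp add: distrib_left conj_polynomial.add)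
  next
    case (scale f c)
    from conj_polynomial.scale[OF scale.IH, of c] show ?case by (simp add: ac_simps)
  qed
next
  case (add f g)
  then show ?case by (simp add: distrib_right conj_polynomial.add)
next
  case (scale f c)
  from conj_polynomial.scale[OF scale.IH, of c] show ?case by (simp add: ac_simps)
qed

lemma conj_polynomial_of_real_polynomial:
  fixes g :: "complex \<Rightarrow> real"
  assumes "real_polynomial_function g"
  shows "conj_polynomial (\<lambda>z. of_real (g z))"
  using assms
proof induction
  case (linear f)
  interpret bounded_linear f by fact
  have z: "conj_polynomial (\<lambda>z. z)" and cz: "conj_polynomial cnj"
    using conj_polynomial.monomial[of 1 0] conj_polynomial.monomial[of 0 1] by simp_all
  \<comment> \<open>Wirtinger coefficients: write \<open>Re z\<close> and \<open>Im z\<close>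
    through \<open>z\<close> and \<open>cnj z\<close> in
    \<open>Re z * f 1 + Im z * f \<i>\<close>.\<close>
  define \<alpha> \<beta> where "\<alpha> = (of_real (f 1) - \<i> * of_real (f \<i>)) / 2"
    and "\<beta> = (of_real (f 1) + \<i> * of_real (f \<i>)) / 2"
  have eq: "of_real (f z) = \<alpha> * z + \<beta> * cnj z" for z
  proof -
    have "z = Re z *\<^sub>R 1 + Im z *\<^sub>R \<i>" by (simp add: complex_eq_iff)
    then have "f z = f (Re z *\<^sub>R 1 + Im z *\<^sub>R \<i>)" by (rule arg_cong)
    also have "\<dots> = Re z * f 1 + Im z * f \<i>" by (simp only: add scaleR real_scaleR_def)
    finally show ?thesis by (simp add: \<alpha>_def \<beta>_def complex_eq_iff field_simps)
  qed
  show ?case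
    unfolding eq by (rule conj_polynomial.add[OF conj_polynomial.scale[OF z] conj_polynomial.scale[OF cz]])
next
  case (const c)
  show ?case by (rule conj_polynomial_const)
next
  case (add f g)
  then show ?case by (simp add: conj_polynomial.add)
next
  case (mult f g)
  then show ?case by (simp add: conj_polynomial_mult)
qed

lemma continuous_on_conj_polynomial: "conj_polynomial f \<Longrightarrow> continuous_on UNIV f"
  by (induction rule: conj_polynomial.induct) (intro continuous_intros; assumption)+

text \<open>Real and imaginary part are approximated separately within \<open>e / 2\<close> by real
  polynomial functions on the plane, which are polynomials in \<open>z\<close> and
  \<open>cnj z\<close>.\<close>

lemma conj_polynomial_dense:
  fixes \<Phi> :: "complex \<Rightarrow> complex"
  assumes S: "compact S" and \<Phi>: "continuous_on S \<Phi>" and e: "e > 0"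
  shows "\<exists>\<Psi>. conj_polynomial \<Psi> \<and> (\<forall>z\<in>S. norm (\<Phi> z - \<Psi> z) < e)"
proof -
  have e2: "e / 2 > 0" using e by simp
  have cont: "continuous_on S (\<lambda>z. Re (\<Phi> z))" "continuous_on S (\<lambda>z. Im (\<Phi> z))"
    using \<Phi> by (auto intro: continuous_intros)
  obtain g where g: "real_polynomial_function g" "\<And>z. z \<in> S \<Longrightarrow> \<bar>Re (\<Phi> z) - g z\<bar> < e / 2"
    by (rule Stone_Weierstrass_real_polynomial_function[OF S cont(1) e2]) (erule that, blast)
  obtain h where h: "real_polynomial_function h" "\<And>z. z \<in> S \<Longrightarrow> \<bar>Im (\<Phi> z) - h z\<bar> < e / 2"
    by (rule Stone_Weierstrass_real_polynomial_function[OF S cont(2) e2]) (erule that, blast)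
  have "conj_polynomial (\<lambda>z. of_real (g z) + \<i> * of_real (h z))"
    by (intro conj_polynomial.add conj_polynomial.scale conj_polynomial_of_real_polynomial g h)
  moreover have "norm (\<Phi> z - (of_real (g z) + \<i> * of_real (h z))) < e" if "z \<in> S" for z
    using cmod_le[of "\<Phi> z - (of_real (g z) + \<i> * of_real (h z))"] g(2)[OF that] h(2)[OF that] by simp
  ultimately show ?thesis by (intro exI[of _ "\<lambda>z. of_real (g z) + \<i> * of_real (h z)"]) blast
qed

section \<open>Convergence of the trace means\<close>

lemma row_entry_one: "i < n + 1 \<Longrightarrow> row_entry n i (1\<^sub>m (n + 1)) k = (if k = 0 then 1 else 0)"
  unfolding row_entry_def by auto

context kms_symbol
begin

abbreviation T :: "nat \<Rightarrow> complex mat" where "T \<equiv> kms_matrix a"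

lemma T_carrier: "T n \<in> carrier_mat (n + 1) (n + 1)"
  unfolding kms_matrix_eq by (rule kms_of_coeffs_carrier)

lemma adjoint_coeff_summable: "(\<lambda>k. A (- k)) summable_on UNIV"
proof -
  have "bij_betw uminus UNIV (UNIV :: int set)" by (rule bij_betwI[of _ _ _ uminus]) auto
  from summable_on_reindex_bij_betw[OF this, of A] A_summable show ?thesis by simp
qed

lemma adjoint_infsum: "(\<Sum>\<^sub>\<infinity>k. A (- k)) = M"
proof -
  have "bij_betw uminus UNIV (UNIV :: int set)" by (rule bij_betwI[of _ _ _ uminus]) auto
  from infsum_reindex_bij_betw[OF this, of A] show ?thesis by (simp add: M_def)
qed

lemma adjoint_series:
  assumes "x \<in> {0..1}" "t \<in> {0..2*pi}"
  shows "((\<lambda>k. cnj (fourier_coeff a (- k) x) * exp (\<i> * of_int k * of_real t)) has_sum cnj (a x t)) UNIV"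
proof -
  have "((\<lambda>k. cnj (fourier_coeff a k x * exp (\<i> * of_int k * of_real t))) has_sum cnj (a x t)) UNIV"
    using series[OF assms] by (subst has_sum_cnj_iff)
  moreover have "bij_betw uminus UNIV (UNIV :: int set)" by (rule bij_betwI[of _ _ _ uminus]) auto
  ultimately have "((\<lambda>k. cnj (fourier_coeff a (- k) x * exp (\<i> * of_int (- k) * of_real t))) has_sum cnj (a x t)) UNIV"
    by (subst has_sum_reindex_bij_betw)
  then show ?thesis by (simp add: exp_cnj)
qed

text \<open>All factors \<open>T n\<close> precede the adjoints, so a word is built by right
  multiplications alone: first \<open>p\<close> times by \<open>T n\<close>, then \<open>q\<close>
  times by its adjoint.\<close>

definition moment_mat :: "nat \<Rightarrow> nat \<Rightarrow> nat \<Rightarrow> complex mat" where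
  "moment_mat p q n = T n ^\<^sub>m p * mat_adjoint (T n) ^\<^sub>m q"

lemma moment_mat_carrier: "moment_mat p q n \<in> carrier_mat (n + 1) (n + 1)"
  unfolding moment_mat_def using T_carrier by (intro mult_carrier_mat[of _ "n + 1" "n + 1"] pow_carrier_mat) auto

lemma moment_mat_0_0: "moment_mat 0 0 n = 1\<^sub>m (n + 1)"
  unfolding moment_mat_def using T_carrier[of n] by simp

lemma moment_mat_Suc_0: "moment_mat (Suc p) 0 n = moment_mat p 0 n * kms_of_coeffs (fourier_coeff a) n"
proof -
  have c: "T n ^\<^sub>m p \<in> carrier_mat (n + 1) (n + 1)" using T_carrier by (rule pow_carrier_mat)
  have c': "T n ^\<^sub>m p * T n \<in> carrier_mat (n + 1) (n + 1)" using c T_carrier by (rule mult_carrier_mat)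
  have d: "dim_row (mat_adjoint (T n)) = n + 1" using T_carrier[of n] by simp
  show ?thesis
    unfolding moment_mat_def kms_matrix_eq[symmetric] pow_mat.simps d
      right_mult_one_mat[OF c] right_mult_one_mat[OF c'] ..
qed

lemma moment_mat_Suc:
  "moment_mat p (Suc q) n = moment_mat p q n * kms_of_coeffs (\<lambda>k x. cnj (fourier_coeff a (- k) x)) n"
proof -
  have c: "T n ^\<^sub>m p \<in> carrier_mat (n + 1) (n + 1)" using T_carrier by (rule pow_carrier_mat)
  have b: "mat_adjoint (T n) \<in> carrier_mat (n + 1) (n + 1)" using T_carrier by (rule mat_adjoint_carrier)
  have b': "mat_adjoint (T n) ^\<^sub>m q \<in> carrier_mat (n + 1) (n + 1)" using b by (rule pow_carrier_mat)
  show ?thesis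
    unfolding moment_mat_def pow_mat.simps assoc_mult_mat[OF c b' b, symmetric]
    unfolding kms_matrix_eq adjoint_kms_of_coeffs ..
qed

text \<open>Starting from the identity, each factor costs at most \<open>M\<close>. The bound is
  uniform in \<open>n\<close>, as both dominated convergence arguments require.\<close>

lemma norm_moment_mat_le:
  assumes "i < n + 1" "j < n + 1"
  shows "norm (moment_mat p q n $$ (i, j)) \<le> M ^ (p + q)"
proof -
  have p: "norm (moment_mat p 0 n $$ (i, j)) \<le> M ^ p" if "i < n + 1" "j < n + 1" for i j
    using that
  proof (induction p arbitrary: i j)
    case 0
    then show ?case by (simp add: moment_mat_0_0)
  next
    case (Suc p)
    from norm_mult_kms_of_coeffs_le[OF A_summable coeff_le moment_mat_carrier Suc.IH Suc.prems]
    show ?case unfolding moment_mat_Suc_0 by (simp add: M_def mult.commute)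
  qed
  have "norm (cnj (fourier_coeff a (- k) x)) \<le> A (- k)" if "x \<in> {0..1}" for k x
    using coeff_le[OF that] by simp
  note step = norm_mult_kms_of_coeffs_le[OF adjoint_coeff_summable this moment_mat_carrier]
  show ?thesis using assms
  proof (induction q arbitrary: i j)
    case 0
    then show ?case using p by simp
  next
    case (Suc q)
    from step[OF _ Suc.IH Suc.prems] show ?case
      unfolding moment_mat_Suc by (simp add: adjoint_infsum mult.commute)
  qed
qed

text \<open>Induction on the word for all \<open>k\<close> at once: the row of the shorter word
  tends to a sequence of Fourier coefficients, and one more factor convolves it with the
  coefficients of \<open>a x\<close> or of its conjugate, giving the coefficients of the
  product.\<close>

lemma moment_row_tendsto:
  assumes x: "0 < x" "x < 1"
    and cont: "\<And>t. t \<in> {0..2*pi} \<Longrightarrow> continuous (at x within {0..1}) (\<lambda>x. a x t)"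
  shows "(\<lambda>n. row_entry n (nat \<lfloor>real (n + 1) * x\<rfloor>) (moment_mat p q n) k)
    \<longlonglongrightarrow> fcoeff (\<lambda>t. a x t ^ p * cnj (a x t) ^ q) k"
proof -
  have x01: "x \<in> {0..1}" using x by simp
  have meas: "(\<lambda>t. a x t ^ p * cnj (a x t) ^ q) \<in> borel_measurable (lebesgue_on {0..2*pi})" for p q
    by (rule measurable_comp_symbol[OF continuous_on_conj_polynomial[OF conj_polynomial.monomial] x01])
  have bound: "norm (a x t ^ p * cnj (a x t) ^ q) \<le> M ^ (p + q)" if "t \<in> {0..2*pi}" for t p q
    using norm_symbol_le[OF x01 that] M_nonneg
    by (simp add: norm_mult norm_power power_add mult_mono power_mono)
  have cont_coeff: "continuous (at x within {0..1}) (fourier_coeff a k)" for k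
  proof -
    have "continuous (at x within {0..1}) (\<lambda>x. LINT t|lebesgue_on {0..2*pi}. a x t * exp (- \<i> * of_int k * of_real t))"
      by (rule integral_continuous_in_point[OF cont continuous_on_id x01, unfolded id_def]) auto
    then show ?thesis unfolding fourier_coeff_def by (intro continuous_intros) auto
  qed
  have cont_coeff': "continuous (at x within {0..1}) (\<lambda>x. cnj (fourier_coeff a (- k) x))" for k
    by (intro continuous_intros cont_coeff)
  have meas1: "a x \<in> borel_measurable (lebesgue_on {0..2*pi})" by (rule measurable_symbol[OF x01])
  have meas2: "(\<lambda>t. cnj (a x t)) \<in> borel_measurable (lebesgue_on {0..2*pi})"
    using meas[of 0 1] by simp
  have coeff_le': "norm (cnj (fourier_coeff a (- k) x)) \<le> A (- k)" if "x \<in> {0..1}" for k x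
    using coeff_le[OF that] by simp
  have p: "(\<lambda>n. row_entry n (nat \<lfloor>real (n + 1) * x\<rfloor>) (moment_mat p 0 n) k)
      \<longlonglongrightarrow> fcoeff (\<lambda>t. a x t ^ p * cnj (a x t) ^ 0) k" for k
  proof (induction p arbitrary: k)
    case 0
    have "row_entry n (nat \<lfloor>real (n + 1) * x\<rfloor>) (moment_mat 0 0 n) k = fcoeff (\<lambda>t. a x t ^ 0 * cnj (a x t) ^ 0) k" for n
      using row_entry_one[OF floor_index_less[of x n]] x by (simp add: moment_mat_0_0 coeff_one)
    then show ?case by simp
  next
    case (Suc p)
    have "(\<Sum>\<^sub>\<infinity>l. fcoeff (\<lambda>t. a x t ^ p * cnj (a x t) ^ 0) l * fourier_coeff a (k - l) x)
        = fcoeff (\<lambda>t. a x t ^ p * cnj (a x t) ^ 0 * a x t) k"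
      by (rule infsumI, rule coeff_mult_has_sum[OF meas meas1 bound A_summable coeff_le[OF x01] series[OF x01]])
    moreover have "(\<lambda>t. a x t ^ p * cnj (a x t) ^ 0 * a x t) = (\<lambda>t. a x t ^ Suc p * cnj (a x t) ^ 0)"
      by (simp add: mult.commute)
    ultimately show ?case
      using row_entry_mult_tendsto[OF x A_summable coeff_le cont_coeff moment_mat_carrier norm_moment_mat_le Suc.IH, of k]
      unfolding moment_mat_Suc_0 by simp
  qed
  show ?thesis
  proof (induction q arbitrary: k)
    case 0
    show ?case by (rule p)
  next
    case (Suc q)
    have "(\<Sum>\<^sub>\<infinity>l. fcoeff (\<lambda>t. a x t ^ p * cnj (a x t) ^ q) l * cnj (fourier_coeff a (- (k - l)) x))
        = fcoeff (\<lambda>t. a x t ^ p * cnj (a x t) ^ q * cnj (a x t)) k"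
      by (rule infsumI, rule coeff_mult_has_sum[OF meas meas2 bound adjoint_coeff_summable coeff_le'[OF x01] adjoint_series[OF x01]])
    moreover have "(\<lambda>t. a x t ^ p * cnj (a x t) ^ q * cnj (a x t)) = (\<lambda>t. a x t ^ p * cnj (a x t) ^ Suc q)"
      by (simp add: mult.commute mult.left_commute)
    ultimately show ?case
      using row_entry_mult_tendsto[OF x adjoint_coeff_summable coeff_le' cont_coeff' moment_mat_carrier norm_moment_mat_le Suc.IH, of k]
      unfolding moment_mat_Suc by simp
  qed
qed

section \<open>The two means: limits on monomials, linearity and bounds\<close>

definition mean_integral :: "(complex \<Rightarrow> complex) \<Rightarrow> complex" where
  "mean_integral \<Phi> = 1 / of_real (2 * pi) *
    (LINT x|lebesgue_on {0..1}. LINT t|lebesgue_on {0..2*pi}. \<Phi> (a x t))"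

definition trace_mean :: "(complex \<Rightarrow> complex) \<Rightarrow> nat \<Rightarrow> complex" where
  "trace_mean \<Phi> n = trace_fun \<Phi> (T n) / of_nat (n + 1)"

text \<open>Offset 0 of a row is its diagonal entry, and the zeroth Fourier coefficient already
  carries the factor \<open>1 / (2 * pi)\<close>.\<close>

lemma moment_trace_tendsto:
  assumes normal: "\<And>n. normal_mat (T n)"
  shows "trace_mean (\<lambda>z. z ^ p * cnj z ^ q) \<longlonglongrightarrow> mean_integral (\<lambda>z. z ^ p * cnj z ^ q)"
proof -
  from symbol_continuous_ae obtain Z where Z: "negligible Z"
    and cont: "\<forall>x\<in>{0..1} - Z. \<forall>t\<in>{0..2*pi}. continuous (at x within {0..1}) (\<lambda>x. a x t)"
    by (elim exE conjE)
  have "(\<lambda>n. (\<Sum>i<n + 1. moment_mat p q n $$ (i, i)) / of_nat (n + 1))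
      \<longlonglongrightarrow> (LINT x|lebesgue_on {0..1}. fcoeff (\<lambda>t. a x t ^ p * cnj (a x t) ^ q) 0)"
  proof (rule step_sequence_integral(2)[OF _ Z])
    show "norm (moment_mat p q n $$ (i, i)) \<le> M ^ (p + q)" if "i < n + 1" for n i
      by (rule norm_moment_mat_le[OF that that])
    fix x assume x: "0 < x" "x < 1" "x \<notin> Z"
    have "row_entry n (nat \<lfloor>real (n + 1) * x\<rfloor>) (moment_mat p q n) 0 =
        moment_mat p q n $$ (nat \<lfloor>real (n + 1) * x\<rfloor>, nat \<lfloor>real (n + 1) * x\<rfloor>)" for n
      using floor_index_less[of x n] x by (simp add: row_entry_def)
    moreover have "(\<lambda>n. row_entry n (nat \<lfloor>real (n + 1) * x\<rfloor>) (moment_mat p q n) 0)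
        \<longlonglongrightarrow> fcoeff (\<lambda>t. a x t ^ p * cnj (a x t) ^ q) 0"
      using x cont by (intro moment_row_tendsto) auto
    ultimately show "(\<lambda>n. moment_mat p q n $$ (nat \<lfloor>real (n + 1) * x\<rfloor>, nat \<lfloor>real (n + 1) * x\<rfloor>))
        \<longlonglongrightarrow> fcoeff (\<lambda>t. a x t ^ p * cnj (a x t) ^ q) 0" by simp
  qed
  moreover have "trace_fun (\<lambda>z. z ^ p * cnj z ^ q) (T n) = (\<Sum>i<n + 1. moment_mat p q n $$ (i, i))" for n
    unfolding moment_mat_def by (rule trace_fun_monomial[OF T_carrier normal])
  moreover have "(LINT x|lebesgue_on {0..1}. fcoeff (\<lambda>t. a x t ^ p * cnj (a x t) ^ q) 0)
      = mean_integral (\<lambda>z. z ^ p * cnj z ^ q)"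
    by (simp add: mean_integral_def fourier_coeff_def)
  ultimately show ?thesis unfolding trace_mean_def by simp
qed

text \<open>Being continuous in \<open>x\<close> off a null set, the inner integral is almost
  everywhere the limit of step functions sampling it at \<open>i / (n + 1)\<close>. This is what
  makes the outer integral additive.\<close>

lemma integrable_inner_integral:
  assumes \<Phi>: "continuous_on UNIV \<Phi>"
  shows "integrable (lebesgue_on {0..1}) (\<lambda>x. LINT t|lebesgue_on {0..2*pi}. \<Phi> (a x t) :: complex)"
proof -
  from symbol_continuous_ae obtain Z where Z: "negligible Z"
    and cont: "\<forall>x\<in>{0..1} - Z. \<forall>t\<in>{0..2*pi}. continuous (at x within {0..1}) (\<lambda>x. a x t)"
    by (elim exE conjE)
  obtain K where "\<forall>z. norm z \<le> M \<longrightarrow> norm (\<Phi> z) \<le> K" using continuous_bounded_on_disk[OF \<Phi>] ..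
  then have K: "norm (\<Phi> z) \<le> K" if "norm z \<le> M" for z using that by blast
  let ?h = "\<lambda>x. LINT t|lebesgue_on {0..2*pi}. \<Phi> (a x t)"
  show ?thesis
  proof (rule step_sequence_integral(1)[OF _ Z, where v = "\<lambda>n i. ?h (real i / real (n + 1))"])
    fix n i :: nat assume "i < n + 1"
    then have "real i / real (n + 1) \<in> {0..1}" by (simp add: divide_le_eq)
    then show "norm (?h (real i / real (n + 1))) \<le> (2 * pi - 0) * K"
      by (intro norm_integral_lebesgue_on_Icc_le measurable_comp_symbol \<Phi> K norm_symbol_le) auto
  next
    fix x assume x: "0 < x" "x < 1" "x \<notin> Z"
    then have x01: "x \<in> {0..1}" by simp
    have "continuous (at x within {0..1}) (\<lambda>x. LINT t|lebesgue_on {0..2*pi}. \<Phi> (a x t) * 1)"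
      using x x01 cont by (intro integral_continuous_in_point \<Phi>) auto
    then have "continuous (at x within {0..1}) ?h" by simp
    then show "(\<lambda>n. ?h (real (nat \<lfloor>real (n + 1) * x\<rfloor>) / real (n + 1))) \<longlonglongrightarrow> ?h x"
    proof (rule continuous_within_tendsto_compose)
      show "(\<lambda>n. real (nat \<lfloor>real (n + 1) * x\<rfloor>) / real (n + 1)) \<longlonglongrightarrow> x"
        by (rule floor_index_div_tendsto) (use x in simp)
      have "real (nat \<lfloor>real (n + 1) * x\<rfloor>) / real (n + 1) \<in> {0..1}" for n
        using floor_index_less[of x n] x by (simp add: divide_le_eq del: of_nat_add)
      then show "\<forall>\<^sub>F n in sequentially. real (nat \<lfloor>real (n + 1) * x\<rfloor>) / real (n + 1) \<in> {0..1}"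
        by simp
    qed
  qed
qed

lemma integrable_comp_symbol:
  assumes \<Phi>: "continuous_on UNIV \<Phi>" and x: "x \<in> {0..1}"
  shows "integrable (lebesgue_on {0..2*pi}) (\<lambda>t. \<Phi> (a x t) :: complex)"
proof -
  obtain K where K: "\<forall>z. norm z \<le> M \<longrightarrow> norm (\<Phi> z) \<le> K" using continuous_bounded_on_disk[OF \<Phi>] ..
  show ?thesis
    by (rule integrable_lebesgue_on_Icc_bounded[OF measurable_comp_symbol[OF \<Phi> x], of K])
      (use K norm_symbol_le[OF x] in blast)
qed

lemma mean_integral_add:
  assumes "continuous_on UNIV f" "continuous_on UNIV g"
  shows "mean_integral (\<lambda>z. f z + g z) = mean_integral f + mean_integral g"
proof -
  have "(LINT t|lebesgue_on {0..2*pi}. f (a x t) + g (a x t)) =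
      (LINT t|lebesgue_on {0..2*pi}. f (a x t)) + (LINT t|lebesgue_on {0..2*pi}. g (a x t))"
    if "x \<in> {0..1}" for x
    using that by (intro Bochner_Integration.integral_add integrable_comp_symbol assms)
  then have "(LINT x|lebesgue_on {0..1}. LINT t|lebesgue_on {0..2*pi}. f (a x t) + g (a x t)) =
      (LINT x|lebesgue_on {0..1}. (LINT t|lebesgue_on {0..2*pi}. f (a x t)) + (LINT t|lebesgue_on {0..2*pi}. g (a x t)))"
    by (intro Bochner_Integration.integral_cong) (auto simp: space_restrict_space)
  then show ?thesis
    unfolding mean_integral_def
    using integrable_inner_integral assms by (simp add: distrib_left)
qed

lemma norm_mean_integral_le:
  assumes \<Phi>: "continuous_on UNIV \<Phi>" and e: "\<And>z. norm z \<le> M \<Longrightarrow> norm (\<Phi> z) \<le> e"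
  shows "norm (mean_integral \<Phi>) \<le> e"
proof -
  have "norm (LINT x|lebesgue_on {0..1}. LINT t|lebesgue_on {0..2*pi}. \<Phi> (a x t)) \<le> (1 - 0) * ((2 * pi - 0) * e)"
    by (intro norm_integral_lebesgue_on_Icc_le measurable_comp_symbol \<Phi> e norm_symbol_le
        borel_measurable_integrable integrable_inner_integral) auto
  then show ?thesis by (simp add: mean_integral_def norm_mult norm_divide divide_le_eq mult.commute)
qed

lemma norm_eigenvalue_kms_le:
  assumes "z \<in># proots (char_poly (T n))"
  shows "norm z \<le> M"
proof (rule norm_eigenvalue_le[OF T_carrier])
  have "char_poly (T n) \<noteq> 0" using degree_monic_char_poly[OF T_carrier[of n]] by auto
  then show "poly (char_poly (T n)) z = 0" using assms by simp
  fix i assume i: "i < n + 1"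
  have "(\<Sum>j<n + 1. norm (T n $$ (i, j))) \<le> (\<Sum>j<n + 1. A (int j - int i))"
  proof (rule sum_mono)
    fix j assume "j \<in> {..<n + 1}"
    then have j: "j < n + 1" by simp
    show "norm (T n $$ (i, j)) \<le> A (int j - int i)"
      unfolding kms_matrix_eq kms_of_coeffs_index[OF i j] by (rule coeff_le[OF sample_point_in_unit[OF i j]])
  qed
  also have "\<dots> \<le> M" unfolding M_def by (rule sum_shift_le_infsum(2)[OF A_summable A_nonneg])
  finally show "(\<Sum>j<n + 1. norm (T n $$ (i, j))) \<le> M" .
qed

lemma trace_mean_cong:
  assumes "\<And>z. norm z \<le> M \<Longrightarrow> f z = g z"
  shows "trace_mean f n = trace_mean g n"
proof -
  have "image_mset f (proots (char_poly (T n))) = image_mset g (proots (char_poly (T n)))"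
    by (intro image_mset_cong assms norm_eigenvalue_kms_le)
  then show ?thesis by (simp add: trace_mean_def trace_fun_def)
qed

lemma trace_mean_add: "trace_mean (\<lambda>z. f z + g z) n = trace_mean f n + trace_mean g n"
  by (simp add: trace_mean_def trace_fun_def sum_mset.distrib add_divide_distrib)

lemma trace_mean_scale: "trace_mean (\<lambda>z. c * f z) n = c * trace_mean f n"
proof -
  have "(\<Sum>z\<in>#R. c * f z) = c * (\<Sum>z\<in>#R. f z)" for R
    by (induction R) (simp_all add: distrib_left)
  then show ?thesis by (simp add: trace_mean_def trace_fun_def)
qed

text \<open>There are exactly \<open>n + 1\<close> roots with multiplicity, all in the disk of
  radius \<open>M\<close>, so this is an average of values of \<open>f\<close> there.\<close>

lemma norm_trace_mean_le:
  assumes e: "\<And>z. norm z \<le> M \<Longrightarrow> norm (f z) \<le> e"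
  shows "norm (trace_mean f n) \<le> e"
proof -
  let ?R = "proots (char_poly (T n))"
  have "norm (\<Sum>z\<in>#R. f z) \<le> of_nat (size R) * e" if "\<And>z. z \<in># R \<Longrightarrow> norm (f z) \<le> e" for R
    using that
  proof (induction R)
    case (add z R)
    have "norm (f z + (\<Sum>z\<in>#R. f z)) \<le> norm (f z) + norm (\<Sum>z\<in>#R. f z)" by (rule norm_triangle_ineq)
    also have "\<dots> \<le> e + of_nat (size R) * e" using add by (intro add_mono) auto
    finally show ?case by (simp add: algebra_simps)
  qed simp
  from this[of ?R] have "norm (\<Sum>z\<in>#?R. f z) \<le> of_nat (size ?R) * e"
    using e norm_eigenvalue_kms_le by blast
  moreover have "size ?R = n + 1"
    using degree_monic_char_poly[OF T_carrier[of n]] by (simp add: size_proots_complex)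
  ultimately have "norm (\<Sum>z\<in>#?R. f z) \<le> real (n + 1) * e" by simp
  moreover have "norm (of_nat (n + 1) :: complex) = real (n + 1)" by (rule norm_of_nat)
  ultimately show ?thesis
    unfolding trace_mean_def trace_fun_def norm_divide
    by (simp add: divide_le_eq mult.commute del: of_nat_add)
qed

lemma trace_mean_tendsto_conj_polynomial:
  assumes normal: "\<And>n. normal_mat (T n)" and "conj_polynomial \<Psi>"
  shows "trace_mean \<Psi> \<longlonglongrightarrow> mean_integral \<Psi>"
  using assms(2)
proof induction
  case (monomial p q)
  show ?case by (rule moment_trace_tendsto[OF normal])
next
  case (add f g)
  then show ?case
    using tendsto_add[OF add.IH] mean_integral_add[of f g] continuous_on_conj_polynomial
    by (simp add: trace_mean_add[abs_def])
next
  case (scale f c)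
  have "mean_integral (\<lambda>z. c * f z) = c * mean_integral f" by (simp add: mean_integral_def)
  then show ?case using tendsto_mult[OF tendsto_const scale.IH, of c] by (simp add: trace_mean_scale[abs_def])
qed

text \<open>The approximation error \<open>\<Delta>\<close> contributes at most \<open>e / 3\<close>
  to each of the two means, uniformly in \<open>n\<close>; the last third is spent on the limit for
  \<open>\<Psi>\<close>.\<close>

lemma trace_mean_tendsto:
  assumes normal: "\<And>n. normal_mat (T n)" and \<Phi>: "continuous_on UNIV \<Phi>"
  shows "trace_mean \<Phi> \<longlonglongrightarrow> mean_integral \<Phi>"
proof (rule tendstoI)
  fix e :: real assume "e > 0"
  then have e3: "e / 3 > 0" by simp
  have "\<exists>\<Psi>. conj_polynomial \<Psi> \<and> (\<forall>z\<in>cball 0 M. norm (\<Phi> z - \<Psi> z) < e / 3)"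
    by (rule conj_polynomial_dense[OF compact_cball continuous_on_subset[OF \<Phi> subset_UNIV] e3])
  then obtain \<Psi> where \<Psi>: "conj_polynomial \<Psi>" and close: "\<forall>z\<in>cball 0 M. norm (\<Phi> z - \<Psi> z) < e / 3"
    by (elim exE conjE)
  define \<Delta> where "\<Delta> z = \<Phi> z - \<Psi> z" for z
  have \<Psi>_cont: "continuous_on UNIV \<Psi>" by (rule continuous_on_conj_polynomial[OF \<Psi>])
  have \<Delta>_cont: "continuous_on UNIV \<Delta>" unfolding \<Delta>_def by (intro continuous_intros \<Phi> \<Psi>_cont)
  have \<Delta>_le: "norm (\<Delta> z) \<le> e / 3" if "norm z \<le> M" for z
    using close that unfolding \<Delta>_def by (simp add: less_imp_le)
  have \<Phi>_eq: "\<Phi> = (\<lambda>z. \<Psi> z + \<Delta> z)" by (simp add: \<Delta>_def)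
  have "\<forall>\<^sub>F n in sequentially. dist (trace_mean \<Psi> n) (mean_integral \<Psi>) < e / 3"
    using trace_mean_tendsto_conj_polynomial[OF normal \<Psi>] e3 by (rule tendstoD)
  then show "\<forall>\<^sub>F n in sequentially. dist (trace_mean \<Phi> n) (mean_integral \<Phi>) < e"
  proof eventually_elim
    case (elim n)
    have "trace_mean \<Phi> n - mean_integral \<Phi> =
        (trace_mean \<Psi> n - mean_integral \<Psi>) + (trace_mean \<Delta> n - mean_integral \<Delta>)"
      unfolding \<Phi>_eq trace_mean_add mean_integral_add[OF \<Psi>_cont \<Delta>_cont] by simp
    also have "norm \<dots> \<le> norm (trace_mean \<Psi> n - mean_integral \<Psi>) + (norm (trace_mean \<Delta> n) + norm (mean_integral \<Delta>))"
      by (intro norm_triangle_le add_left_mono norm_triangle_ineq4)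
    finally show ?case
      using elim norm_trace_mean_le[of \<Delta> "e / 3" n, OF \<Delta>_le] norm_mean_integral_le[of \<Delta> "e / 3", OF \<Delta>_cont \<Delta>_le]
      by (simp add: dist_norm)
  qed
qed

end

theorem theorem2p1:
  fixes a :: "real \<Rightarrow> real \<Rightarrow> complex" and \<phi> :: "complex \<Rightarrow> complex"
  assumes fourier_series: "\<And>x t. x \<in> {0..1} \<Longrightarrow> t \<in> {0..2*pi} \<Longrightarrow>
      ((\<lambda>k. fourier_coeff a k x * exp (\<i> * of_int k * of_real t)) has_sum a x t) UNIV"
    and riemann: "\<And>t. t \<in> {0..2*pi} \<Longrightarrow> (\<lambda>x. a x t) riemann_integrable_on {0..1}"
    and bounded: "\<And>x. x \<in> {0..1} \<Longrightarrow> (\<lambda>t. a x t) essentially_bounded_on {0..2*pi}"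
    and norm_finite: "symbol_norm a < \<infinity>"
    and normal: "\<And>n. normal_mat (kms_matrix a n)"
    and phi_cont: "continuous_on (symbol_disk a) \<phi>"
  shows "(\<lambda>n. trace_fun \<phi> (kms_matrix a n) / of_nat (n + 1)) \<longlonglongrightarrow>
      1 / of_real (2 * pi) *
        (LINT x|lebesgue_on {0..1}. LINT t|lebesgue_on {0..2*pi}. \<phi> (a x t))"
proof -
  define s where "s k = (SUP x\<in>{0..1}. ennreal (norm (fourier_coeff a k x)))" for k
  \<comment> \<open>\<open>enn2real\<close> would send infinity to 0, so finiteness of each
    supremum, which follows from that of the norm, is needed before \<open>A\<close> can act as a
    majorant.\<close>
  define A where "A k = enn2real (s k)" for k
  have norm_eq: "symbol_norm a = (\<Sum>\<^sub>\<infinity>k. s k)" by (simp add: symbol_norm_def s_def)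
  have sum_s: "(\<Sum>k\<in>F. s k) \<le> symbol_norm a" if "finite F" for F
    unfolding norm_eq using that by (subst nonneg_infsum_complete) (auto intro!: SUP_upper)
  have s_fin: "s k < \<infinity>" for k using sum_s[of "{k}"] norm_finite by simp
  have s_A: "s k = ennreal (A k)" for k unfolding A_def using s_fin[of k] by simp
  have A0: "0 \<le> A k" for k by (simp add: A_def)
  have sum_A: "(\<Sum>k\<in>F. A k) \<le> enn2real (symbol_norm a)" if "finite F" for F
  proof -
    have "ennreal (\<Sum>k\<in>F. A k) = (\<Sum>k\<in>F. s k)" unfolding s_A using A0 by simp
    also have "\<dots> \<le> ennreal (enn2real (symbol_norm a))" using sum_s[OF that] norm_finite by simp
    finally show ?thesis by (simp add: ennreal_le_iff)
  qed
  have A_sum: "A summable_on UNIV"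
    by (rule nonneg_bdd_above_summable_on[OF A0]) (auto intro!: bdd_aboveI2[of _ _ "enn2real (symbol_norm a)"] sum_A)
  interpret kms_symbol a A
  proof
    show "norm (fourier_coeff a k x) \<le> A k" if "x \<in> {0..1}" for k x
    proof -
      have "ennreal (norm (fourier_coeff a k x)) \<le> ennreal (A k)"
        unfolding s_A[symmetric] s_def using that by (rule SUP_upper)
      then show ?thesis using A0 by (simp add: ennreal_le_iff)
    qed
    show "a x \<in> borel_measurable (lebesgue_on {0..2*pi})" if "x \<in> {0..1}" for x
      using bounded[OF that] unfolding essentially_bounded_on_def by simp
  qed (use fourier_series riemann A_sum in auto)
  have "M \<le> enn2real (symbol_norm a)"
    unfolding M_def by (rule infsum_le_finite_sums[OF A_sum]) (rule sum_A)
  then have "ennreal M \<le> ennreal (enn2real (symbol_norm a))" by (rule ennreal_leI)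
  also have "\<dots> = symbol_norm a" using norm_finite by simp
  finally have M_le: "ennreal M \<le> symbol_norm a" .
  have disk: "cball 0 M \<subseteq> symbol_disk a"
    unfolding symbol_disk_def using M_le by (auto intro: order_trans[OF ennreal_leI])
  \<comment> \<open>Nearest-point projection extends \<open>\<phi>\<close> from the disk of radius
    \<open>M\<close> to a continuous function on the plane. It fixes the eigenvalues and the values
    of the symbol, so neither side of the limit changes.\<close>
  define \<Phi> where "\<Phi> z = \<phi> (closest_point (cball 0 M) z)" for z
  have ne: "cball (0::complex) M \<noteq> {}" using M_nonneg by simp
  have proj: "closest_point (cball 0 M) z \<in> cball 0 M" for z :: complex
    by (rule closest_point_in_set[OF closed_cball ne])
  have "continuous_on UNIV (closest_point (cball (0::complex) M))"
    by (rule continuous_on_closest_point[OF convex_cball closed_cball ne])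
  then have "continuous_on UNIV \<Phi>"
    unfolding \<Phi>_def using proj
    by (intro continuous_on_compose2[OF continuous_on_subset[OF phi_cont disk]]) auto
  then have "trace_mean \<Phi> \<longlonglongrightarrow> mean_integral \<Phi>" by (rule trace_mean_tendsto[OF normal])
  moreover have \<Phi>_eq: "\<Phi> z = \<phi> z" if "norm z \<le> M" for z
    using that closest_point_self[of z "cball 0 M"] by (simp add: \<Phi>_def)
  then have "trace_mean \<Phi> = trace_mean \<phi>" by (intro ext trace_mean_cong)
  moreover have "mean_integral \<Phi> = mean_integral \<phi>"
    unfolding mean_integral_def
    by (intro arg_cong2[where f = "(*)"] refl Bochner_Integration.integral_cong \<Phi>_eq norm_symbol_le)
      (auto simp: space_restrict_space)
  ultimately show ?thesis by (simp add: trace_mean_def[abs_def] mean_integral_def)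
qed

end
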